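(* Let $G$ be a non-compact locally compact $E$-group having an $E$-set $X$ with compact covering number $\kappa$. Then the quotient space $\mathscr{WAP}_0(G)/C_0(G)$ contains a linear isometric copy of $\ell_\infty(\kappa)$.
   Context: All groups are Hausdorff, with identity $e$. A locally compact group $G$ is an $E$-group if it contains a non-relatively compact set $X$ such that for each neighbourhood $U$ of $e$ the set $\bigcap\{x^{-1}Ux : x\in X\cup X^{-1}\}$ is again a neighbourhood of $e$; such a set $X$ is called an $E$-set. The compact covering number $\kappa=\kappa(X)$ of $X\subseteq G$ is the minimal number of compact subsets of $G$ required to cover $X$. $\mathscr{CB}(G)$ is the algebra of bounded continuous complex-valued functions with the supremum norm; $C_0(G)$ is the subalgebra of functions vanishing at infinity. $\mathscr{WAP}(G)$ is the algebra of $f\in\mathscr{CB}(G)$ whose set of left translates $\{f_s:s\in G\}$, $f_s(t)=f(st)$, is relatively weakly compact in $\mathscr{CB}(G)$. With $\mu$ the unique invariant mean on $\mathscr{WAP}(G)$, $\mathscr{WAP}_0(G)=\{f\in\mathscr{WAP}(G):\mu(|f|)=0\}$. $\ell_\infty(\kappa)$ is the space of bounded complex functions on $\kappa$ with the supremum norm. A Banach space contains a linear isometric copy of $\ell_\infty(\kappa)$ if there is a linear (not necessarily surjective) isometry of $\ell_\infty(\kappa)$ into it. Quotients carry the quotient norm. *)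

theory Defs
  imports "HOL-Analysis.Analysis"
begin

unbundle cardinal_syntax and bcontfun.lifting

(* HOL-Library.Set_Algebras uses the same symbol as equality of cardinals. *)
no_notation elt_set_eq (infix "=o" 50)

text \<open>
  Topological groups are types of class \<open>topological_group_add\<close>.  The operation is written
  additively, but \<open>group_add\<close> does not assume commutativity: \<open>x + y\<close> stands for the product
  \<open>xy\<close>, \<open>- x\<close> for the inverse and \<open>0\<close> for the identity.
\<close>


subsection \<open>E-groups\<close>

definition E_set :: "'a::topological_group_add set \<Rightarrow> bool" where
  "E_set X \<longleftrightarrow>
     \<not> compact (closure X) \<and>
     (\<forall>U. 0 \<in> interior U \<longrightarrow>
        0 \<in> interior (\<Inter>x\<in>X \<union> uminus ` X. (\<lambda>u. - x + u + x) ` U))"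

definition E_group :: "'a::topological_group_add itself \<Rightarrow> bool" where
  "E_group _ \<longleftrightarrow>
     locally_compact_space (euclidean :: 'a topology) \<and> (\<exists>X :: 'a set. E_set X)"


subsection \<open>Compact covering number\<close>

definition compact_cover :: "'a::topological_space set \<Rightarrow> 'a set set \<Rightarrow> bool" where
  "compact_cover X \<C> \<longleftrightarrow> (\<forall>K\<in>\<C>. compact K) \<and> X \<subseteq> \<Union>\<C>"

text \<open>
  Cardinals are well-orders \<open>\<kappa>\<close> with \<open>Card_order \<kappa>\<close>, which are determined only up to \<open>=o\<close>;
  \<open>Field \<kappa>\<close> is the underlying set.
\<close>

definition is_compact_covering_number :: "'a::topological_space set \<Rightarrow> 'k rel \<Rightarrow> bool" where
  "is_compact_covering_number X \<kappa> \<longleftrightarrow>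
     Card_order \<kappa> \<and>
     (\<exists>\<C>. compact_cover X \<C> \<and> |\<C>| =o \<kappa>) \<and>
     (\<forall>\<C>. compact_cover X \<C> \<longrightarrow> \<kappa> \<le>o |\<C>| )"


subsection \<open>Bounded continuous functions\<close>

text \<open>
  The space of bounded continuous complex-valued functions with the supremum norm is the type
  \<open>'a \<Rightarrow>\<^sub>C complex\<close>, for which the library provides only the real vector space operations.
\<close>

lift_definition cscale ::
  "complex \<Rightarrow> ('a::topological_space \<Rightarrow>\<^sub>C complex) \<Rightarrow> ('a \<Rightarrow>\<^sub>C complex)"
  is "\<lambda>c f t. c * f t"
proof -
  fix c :: complex and f :: "'a \<Rightarrow> complex"
  assume "f \<in> bcontfun"
  then have f: "continuous_on UNIV f" "bounded (range f)"
    by (simp_all add: bcontfun_def)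
  have "bounded ((\<lambda>z. c * z) ` range f)"
    by (rule bounded_linear_image[OF f(2) bounded_linear_mult_right])
  then show "(\<lambda>t. c * f t) \<in> bcontfun"
    using f(1) by (simp add: bcontfun_def image_image continuous_on_mult_left)
qed

lift_definition cb_abs ::
  "('a::topological_space \<Rightarrow>\<^sub>C complex) \<Rightarrow> ('a \<Rightarrow>\<^sub>C complex)"
  is "\<lambda>f t. complex_of_real (cmod (f t))"
  by (auto simp: bcontfun_def bounded_iff intro!: continuous_intros)

lift_definition left_translate ::
  "'a::topological_group_add \<Rightarrow> ('a \<Rightarrow>\<^sub>C complex) \<Rightarrow> ('a \<Rightarrow>\<^sub>C complex)"
  is "\<lambda>s f t. f (s + t)"
proof -
  fix s :: 'a and f :: "'a \<Rightarrow> complex"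
  assume "f \<in> bcontfun"
  then have f: "continuous_on UNIV f" "bounded (range f)"
    by (simp_all add: bcontfun_def)
  have "continuous_on UNIV (\<lambda>t. f (s + t))"
    by (rule continuous_on_compose2[OF f(1)])
       (simp_all add: continuous_on_add continuous_on_const continuous_on_id)
  moreover have "bounded (range (\<lambda>t. f (s + t)))"
    by (rule bounded_subset[OF f(2)]) blast
  ultimately show "(\<lambda>t. f (s + t)) \<in> bcontfun"
    by (simp add: bcontfun_def)
qed

lift_definition right_translate ::
  "'a::topological_group_add \<Rightarrow> ('a \<Rightarrow>\<^sub>C complex) \<Rightarrow> ('a \<Rightarrow>\<^sub>C complex)"
  is "\<lambda>s f t. f (t + s)"
proof -
  fix s :: 'a and f :: "'a \<Rightarrow> complex"
  assume "f \<in> bcontfun"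
  then have f: "continuous_on UNIV f" "bounded (range f)"
    by (simp_all add: bcontfun_def)
  have "continuous_on UNIV (\<lambda>t. f (t + s))"
    by (rule continuous_on_compose2[OF f(1)])
       (simp_all add: continuous_on_add continuous_on_const continuous_on_id)
  moreover have "bounded (range (\<lambda>t. f (t + s)))"
    by (rule bounded_subset[OF f(2)]) blast
  ultimately show "(\<lambda>t. f (t + s)) \<in> bcontfun"
    by (simp add: bcontfun_def)
qed

definition C0 :: "('a::topological_space \<Rightarrow>\<^sub>C complex) set" where
  "C0 = {f. \<forall>\<epsilon>>0. \<exists>K. compact K \<and> (\<forall>t. t \<notin> K \<longrightarrow> cmod (apply_bcontfun f t) < \<epsilon>)}"


subsection \<open>Weakly almost periodic functions\<close>

definition cb_dual :: "(('a::topological_space \<Rightarrow>\<^sub>C complex) \<Rightarrow> complex) set" where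
  "cb_dual = {\<phi>. bounded_linear \<phi> \<and> (\<forall>c f. \<phi> (cscale c f) = c * \<phi> f)}"

definition weak_topology :: "('a::topological_space \<Rightarrow>\<^sub>C complex) topology" where
  "weak_topology = topology_generated_by {\<phi> -` W | \<phi> W. \<phi> \<in> cb_dual \<and> open W}"

definition WAP :: "('a::topological_group_add \<Rightarrow>\<^sub>C complex) set" where
  "WAP = {f. compactin weak_topology (weak_topology closure_of range (\<lambda>s. left_translate s f))}"

text \<open>
  A mean on \<open>WAP\<close> is a linear functional \<open>\<mu>\<close> with \<open>\<parallel>\<mu>\<parallel> = \<mu>(1) = 1\<close>.  Only the values of \<open>\<mu>\<close> on
  \<open>WAP\<close> are constrained.
\<close>

definition invariant_mean_WAP :: "(('a::topological_group_add \<Rightarrow>\<^sub>C complex) \<Rightarrow> complex) \<Rightarrow> bool" where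
  "invariant_mean_WAP \<mu> \<longleftrightarrow>
     (\<forall>f\<in>WAP. \<forall>g\<in>WAP. \<mu> (f + g) = \<mu> f + \<mu> g) \<and>
     (\<forall>c. \<forall>f\<in>WAP. \<mu> (cscale c f) = c * \<mu> f) \<and>
     (\<forall>f\<in>WAP. cmod (\<mu> f) \<le> norm f) \<and>
     \<mu> (const_bcontfun 1) = 1 \<and>
     (\<forall>s. \<forall>f\<in>WAP. \<mu> (left_translate s f) = \<mu> f \<and> \<mu> (right_translate s f) = \<mu> f)"

definition WAP0 ::
  "(('a::topological_group_add \<Rightarrow>\<^sub>C complex) \<Rightarrow> complex) \<Rightarrow> ('a \<Rightarrow>\<^sub>C complex) set" where
  "WAP0 \<mu> = {f \<in> WAP. \<mu> (cb_abs f) = 0}"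


subsection \<open>Quotients of subspaces of bounded continuous functions\<close>

text \<open>
  Elements of the quotient \<open>V/N\<close> are the cosets \<open>f +o N\<close> with \<open>f \<in> V\<close>.  Their addition is the
  addition of sets from \<open>HOL-Library.Set_Algebras\<close>.  In \<open>quotient_scale\<close> the summand \<open>N\<close> only
  matters for \<open>c = 0\<close>, where \<open>0 \<cdot> A\<close> must be \<open>N\<close> rather than \<open>{0}\<close>.  The quotient norm of a coset,
  i.e. the distance of a representative from \<open>N\<close>, is the infimum of the norms of its elements.
\<close>

definition quotient_space ::
  "('a::topological_space \<Rightarrow>\<^sub>C complex) set \<Rightarrow> ('a \<Rightarrow>\<^sub>C complex) set \<Rightarrow> ('a \<Rightarrow>\<^sub>C complex) set set" where
  "quotient_space V N = (\<lambda>f. f +o N) ` V"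

definition quotient_scale ::
  "('a::topological_space \<Rightarrow>\<^sub>C complex) set \<Rightarrow> complex \<Rightarrow> ('a \<Rightarrow>\<^sub>C complex) set \<Rightarrow> ('a \<Rightarrow>\<^sub>C complex) set" where
  "quotient_scale N c A = cscale c ` A + N"

definition quotient_norm :: "('a::topological_space \<Rightarrow>\<^sub>C complex) set \<Rightarrow> real" where
  "quotient_norm A = (INF f\<in>A. norm f)"


subsection \<open>Isometric copies of the space of bounded functions on a set\<close>

text \<open>Functions on the set \<open>S\<close> are represented by functions that vanish outside \<open>S\<close>.\<close>

definition linf :: "'k set \<Rightarrow> ('k \<Rightarrow> complex) set" where
  "linf S = {\<xi>. bounded (\<xi> ` S) \<and> (\<forall>i. i \<notin> S \<longrightarrow> \<xi> i = 0)}"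

text \<open>Inserting \<open>0\<close> only matters for \<open>S = {}\<close>.\<close>

definition linf_norm :: "'k set \<Rightarrow> ('k \<Rightarrow> complex) \<Rightarrow> real" where
  "linf_norm S \<xi> = Sup (insert 0 ((\<lambda>i. cmod (\<xi> i)) ` S))"

definition quotient_contains_isometric_linf ::
  "('a::topological_space \<Rightarrow>\<^sub>C complex) set \<Rightarrow> ('a \<Rightarrow>\<^sub>C complex) set \<Rightarrow> 'k set \<Rightarrow> bool" where
  "quotient_contains_isometric_linf V N S \<longleftrightarrow>
     (\<exists>T :: ('k \<Rightarrow> complex) \<Rightarrow> ('a \<Rightarrow>\<^sub>C complex) set.
        (\<forall>\<xi>\<in>linf S. T \<xi> \<in> quotient_space V N) \<and>
        (\<forall>\<xi>\<in>linf S. \<forall>\<eta>\<in>linf S. T (\<lambda>i. \<xi> i + \<eta> i) = T \<xi> + T \<eta>) \<and>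
        (\<forall>c. \<forall>\<xi>\<in>linf S. T (\<lambda>i. c * \<xi> i) = quotient_scale N c (T \<xi>)) \<and>
        (\<forall>\<xi>\<in>linf S. quotient_norm (T \<xi>) = linf_norm S \<xi>))"

end

theory Submission
  imports Defs
begin

text \<open>
  The group is written additively, as in the definitions.  Points \<open>x i\<close> of the E-set \<open>X\<close>, with
  \<open>i\<close> in the field of \<open>\<kappa>\<close>, are chosen by transfinite recursion so that they form a Sidon set modulo
  a compact neighbourhood \<open>P\<close> of \<open>0\<close>: an equation \<open>x i + p - x j = x k + q - x l\<close> with \<open>p, q \<in> P\<close>
  never holds for four distinct indices.  At each step the next point has to avoid one compact set
  for every triple of earlier points, so fewer than \<open>\<kappa>\<close> compact sets, and these do not cover \<open>X\<close>
  (\<open>transfinite_free_sequence\<close>, \<open>free_imp_sidon\<close>).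

  Let \<open>b\<close> be a bump function with \<open>b 0 = 1\<close> and support in a small neighbourhood of \<open>0\<close>.  A bounded
  family \<open>c\<close> gives the bump sum \<open>f\<close> with value \<open>\<Sum>i. c i * b (- x i + t)\<close> at \<open>t\<close>, whose summands have
  disjoint supports.  Since \<open>X\<close> is an E-set, conjugation by all \<open>x i\<close> simultaneously keeps small
  neighbourhoods small.  Hence \<open>f\<close> is uniformly continuous, and its translates depend continuously,
  in norm, on the translating element.

  The main point is that \<open>f\<close> is weakly almost periodic.  By the Sidon property, two translates of \<open>f\<close>
  by elements that are far apart meet only in a few bumps.  From a set of translating elements that
  is not relatively compact one can therefore select a sequence whose translates of \<open>f\<close> have the form
  \<open>h n + g n\<close>, where \<open>h n\<close> is a multiple of a single bump located in a fixed compact set, and at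
  most three of the functions \<open>g n\<close> are nonzero at any given point (\<open>translates_decompose\<close>).  Then
  every finite sum of unimodular multiples of the \<open>g n\<close> is bounded by one constant, so that
  \<open>\<phi> (g n)\<close> is absolutely summable for each functional \<open>\<phi>\<close>, and \<open>g n\<close> tends weakly to \<open>0\<close>.  Consequently
  a weakly open set that contains \<open>0\<close> and all multiples of translated bumps by scalars of the size
  of the coefficients also contains all translates of \<open>f\<close> by elements outside a compact set, and the
  weak compactness of the orbit closure can be read off from open covers (\<open>compactin_weak_criterion\<close>).

  The same decomposition shows that \<open>f\<close> has mean zero: single bumps have mean zero, so the sum
  of the first \<open>n\<close> functions \<open>g\<close> has mean \<open>n * \<mu> f\<close>, while its norm stays bounded.  As \<open>\<bar>f\<bar>\<close> is again a
  bump sum, \<open>f\<close> lies in \<open>WAP0 \<mu>\<close>.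

  Finally, every coordinate \<open>i\<close> of a bounded function \<open>\<xi>\<close> is repeated along infinitely many points
  \<open>x j\<close>.  These leave every compact set, so subtracting a function that vanishes at infinity cannot
  push the supremum below \<open>cmod (\<xi> i)\<close> (\<open>norm_bump_sum_plus_C0_ge\<close>).  The coset of the bump sum is
  therefore a linear isometric image of \<open>\<xi>\<close>.
\<close>

section \<open>The weak topology\<close>

lemma openin_weak_vimage:
  assumes "\<phi> \<in> cb_dual" "open W"
  shows "openin weak_topology (\<phi> -` W)"
  unfolding weak_topology_def using assms
  by (intro topology_generated_by_Basis) blast

lemma apply_cscale [simp]: "apply_bcontfun (cscale c f) t = c * apply_bcontfun f t"
  by transfer simp

lemma apply_left_translate [simp]: "apply_bcontfun (left_translate s f) t = apply_bcontfun f (s + t)"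
  by transfer simp

lemma apply_cb_abs [simp]: "apply_bcontfun (cb_abs f) t = complex_of_real (cmod (apply_bcontfun f t))"
  by transfer simp

lemma evaluation_in_cb_dual: "(\<lambda>f. apply_bcontfun f t) \<in> cb_dual"
proof -
  have "bounded_linear (\<lambda>f :: 'a \<Rightarrow>\<^sub>C complex. apply_bcontfun f t)"
    by (rule bounded_linear_intro[where K=1]) (auto simp: norm_bounded)
  then show ?thesis by (simp add: cb_dual_def)
qed

lemma topspace_weak [simp]: "topspace (weak_topology :: ('a::topological_space \<Rightarrow>\<^sub>C complex) topology) = UNIV"
proof -
  have "openin weak_topology ((\<lambda>f :: 'a \<Rightarrow>\<^sub>C complex. apply_bcontfun f undefined) -` UNIV)"
    by (rule openin_weak_vimage[OF evaluation_in_cb_dual]) simp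
  then show ?thesis
    using openin_subset by fastforce
qed

lemma Hausdorff_weak: "Hausdorff_space (weak_topology :: ('a::topological_space \<Rightarrow>\<^sub>C complex) topology)"
  unfolding Hausdorff_space_def topspace_weak
proof (intro allI impI, elim conjE)
  fix f g :: "'a \<Rightarrow>\<^sub>C complex"
  assume "f \<noteq> g"
  then obtain t where "f t \<noteq> g t"
    by (metis bcontfun_eqI)
  then obtain A B where AB: "open A" "open B" "f t \<in> A" "g t \<in> B" "A \<inter> B = {}"
    by (metis hausdorff)
  let ?e = "\<lambda>f :: 'a \<Rightarrow>\<^sub>C complex. apply_bcontfun f t"
  show "\<exists>U V. openin weak_topology U \<and> openin weak_topology V \<and> f \<in> U \<and> g \<in> V \<and> disjnt U V"
    using AB openin_weak_vimage[OF evaluation_in_cb_dual[of t]]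
    by (intro exI[of _ "?e -` A"] exI[of _ "?e -` B"]) (auto simp: disjnt_def)
qed

text \<open>
  Finite intersections of the generating sets form a base of the weak topology; the neighbourhoods
  can be centred at the given point.
\<close>

lemma openin_weak_imp_basic:
  assumes "openin weak_topology U" "h \<in> U"
  shows "\<exists>\<Phi> \<epsilon>. finite \<Phi> \<and> \<Phi> \<subseteq> cb_dual \<and> \<epsilon> > 0 \<and> {g. \<forall>\<phi>\<in>\<Phi>. cmod (\<phi> g - \<phi> h) < \<epsilon>} \<subseteq> U"
  using assms(1)[unfolded weak_topology_def openin_topology_generated_by_iff] assms(2)
proof (induction arbitrary: h)
  case Empty
  then show ?case by simp
next
  case (Int A B)
  from Int obtain \<Phi> \<epsilon> \<Psi> \<delta> where *:
    "finite \<Phi>" "\<Phi> \<subseteq> cb_dual" "\<epsilon> > 0" "{g. \<forall>\<phi>\<in>\<Phi>. cmod (\<phi> g - \<phi> h) < \<epsilon>} \<subseteq> A"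
    "finite \<Psi>" "\<Psi> \<subseteq> cb_dual" "\<delta> > 0" "{g. \<forall>\<phi>\<in>\<Psi>. cmod (\<phi> g - \<phi> h) < \<delta>} \<subseteq> B"
    by (meson IntE)
  show ?case
    by (rule exI[of _ "\<Phi> \<union> \<Psi>"], rule exI[of _ "min \<epsilon> \<delta>"]) (use * in auto)
next
  case (UN K)
  then obtain k where "k \<in> K" "h \<in> k" by blast
  with UN.IH[of k h] show ?case by blast
next
  case (Basis s)
  then obtain \<phi> W where s: "s = \<phi> -` W" "\<phi> \<in> cb_dual" "open W" by blast
  with Basis obtain e where e: "e > 0" "ball (\<phi> h) e \<subseteq> W"
    by (auto simp: open_contains_ball)
  show ?case
    by (rule exI[of _ "{\<phi>}"], rule exI[of _ e])
       (use s e in \<open>auto simp: ball_def dist_norm norm_minus_commute\<close>)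
qed

lemma openin_weak_imp_open:
  assumes "openin weak_topology U"
  shows "open (U :: ('a::topological_space \<Rightarrow>\<^sub>C complex) set)"
  using assms[unfolded weak_topology_def openin_topology_generated_by_iff]
proof induction
  case (Basis s)
  then obtain \<phi> W where s: "s = \<phi> -` W" "\<phi> \<in> cb_dual" "open W" by blast
  then show ?case
    by (auto simp: cb_dual_def linear_continuous_on intro!: open_vimage)
qed auto

lemma compact_imp_compactin_weak:
  assumes "compact K"
  shows "compactin weak_topology K"
  unfolding compactin_def
proof (intro conjI allI impI)
  fix \<U> assume "(\<forall>U\<in>\<U>. openin weak_topology U) \<and> K \<subseteq> \<Union>\<U>"
  then show "\<exists>\<F>. finite \<F> \<and> \<F> \<subseteq> \<U> \<and> K \<subseteq> \<Union>\<F>"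
    using compactE[OF assms, of \<U>] by (metis openin_weak_imp_open)
qed simp

lemma bounded_bilinear_cscale: "bounded_bilinear (cscale :: complex \<Rightarrow> ('a::topological_space \<Rightarrow>\<^sub>C complex) \<Rightarrow> _)"
proof
  fix c c' :: complex and f g :: "'a \<Rightarrow>\<^sub>C complex" and r :: real
  show "cscale (c + c') f = cscale c f + cscale c' f"
    by (rule bcontfun_eqI) (simp add: distrib_right)
  show "cscale c (f + g) = cscale c f + cscale c g"
    by (rule bcontfun_eqI) (simp add: distrib_left)
  show "cscale (r *\<^sub>R c) f = r *\<^sub>R cscale c f" "cscale c (r *\<^sub>R f) = r *\<^sub>R cscale c f"
    by (rule bcontfun_eqI; simp)+
  have "norm (cscale c f) \<le> norm c * norm f * 1" for c and f :: "'a \<Rightarrow>\<^sub>C complex"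
    by (rule norm_bound) (simp add: norm_mult mult_left_mono norm_bounded)
  then show "\<exists>K. \<forall>c (f :: 'a \<Rightarrow>\<^sub>C complex). norm (cscale c f) \<le> norm c * norm f * K"
    by blast
qed

section \<open>Weakly null sequences of functions with bounded overlap\<close>

text \<open>
  The functions may be nonzero at the same point, but their absolute values have a bounded sum.
  This is the pointwise form of weak unconditional summability in the supremum norm, and it is all
  that is used of the combinatorics of supports.
\<close>

definition bounded_overlap :: "(nat \<Rightarrow> 'a \<Rightarrow> complex) \<Rightarrow> bool" where
  "bounded_overlap g \<longleftrightarrow> (\<exists>B. \<forall>t J. finite J \<longrightarrow> (\<Sum>j\<in>J. cmod (g j t)) \<le> B)"

lemma sum_apply_bcontfun: "apply_bcontfun (\<Sum>j\<in>J. g j) t = (\<Sum>j\<in>J. apply_bcontfun (g j) t)"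
  by (induction J rule: infinite_finite_induct) auto

text \<open>
  Multiplying each \<open>g j\<close> by a scalar of modulus one that turns \<open>\<phi> (g j)\<close> into its absolute value
  changes the norm of a finite sum by no more than the overlap bound, so the absolute values
  \<open>cmod (\<phi> (g j))\<close> are summable.
\<close>

lemma bounded_overlap_imp_weakly_null:
  fixes g :: "nat \<Rightarrow> 'a::topological_space \<Rightarrow>\<^sub>C complex"
  assumes g: "bounded_overlap (\<lambda>j. apply_bcontfun (g j))" and \<phi>: "\<phi> \<in> cb_dual"
  shows "(\<lambda>j. \<phi> (g j)) \<longlonglongrightarrow> 0"
proof -
  obtain B where B: "\<And>t J. finite J \<Longrightarrow> (\<Sum>j\<in>J. cmod (g j t)) \<le> B"
    using g unfolding bounded_overlap_def by blast
  have lin: "bounded_linear \<phi>" and scale: "\<And>c f. \<phi> (cscale c f) = c * \<phi> f"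
    using \<phi> by (auto simp: cb_dual_def)
  have "(\<Sum>j\<in>J. cmod (\<phi> (g j))) \<le> onorm \<phi> * B" if J: "finite J" for J
  proof -
    \<comment> \<open>The factors have modulus at most one and make all values of \<open>\<phi>\<close> nonnegative.\<close>
    define G where "G = (\<Sum>j\<in>J. cscale (cnj (sgn (\<phi> (g j)))) (g j))"
    have sgn: "cnj (sgn z) * z = complex_of_real (cmod z)" for z
      using complex_norm_square[of z]
      by (cases "z = 0") (simp_all add: sgn_eq power2_eq_square divide_eq_eq mult.commute)
    have "norm G \<le> B"
    proof (rule norm_bound)
      fix t
      have "norm (G t) \<le> (\<Sum>j\<in>J. cmod (cnj (sgn (\<phi> (g j))) * g j t))"
        unfolding G_def sum_apply_bcontfun by (auto intro: order_trans[OF norm_sum])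
      also have "\<dots> \<le> (\<Sum>j\<in>J. cmod (g j t))"
        by (intro sum_mono) (auto simp: norm_mult norm_sgn)
      finally show "norm (G t) \<le> B" using B[OF J, of t] by linarith
    qed
    have "\<phi> G = (\<Sum>j\<in>J. cnj (sgn (\<phi> (g j))) * \<phi> (g j))"
      unfolding G_def by (simp add: linear_sum[OF bounded_linear.linear[OF lin]] scale)
    also have "\<dots> = complex_of_real (\<Sum>j\<in>J. cmod (\<phi> (g j)))"
      by (simp add: sgn)
    finally have "(\<Sum>j\<in>J. cmod (\<phi> (g j))) = cmod (\<phi> G)"
      by (simp add: sum_nonneg del: of_real_sum)
    also have "\<dots> \<le> onorm \<phi> * norm G"
      by (rule onorm[OF lin])
    also have "\<dots> \<le> onorm \<phi> * B"
      by (intro mult_left_mono \<open>norm G \<le> B\<close> onorm_pos_le lin)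
    finally show ?thesis .
  qed
  then have "summable (\<lambda>j. cmod (\<phi> (g j)))"
    by (intro summableI_nonneg_bounded[where x = "onorm \<phi> * B"]) auto
  then show ?thesis
    using summable_LIMSEQ_zero tendsto_norm_zero_iff by blast
qed

lemma bounded_overlapI:
  assumes C: "\<And>j t. cmod (g j t) \<le> C"
    and m: "\<And>t J. finite J \<Longrightarrow> \<forall>j\<in>J. g j t \<noteq> 0 \<Longrightarrow> card J \<le> m"
  shows "bounded_overlap g"
  unfolding bounded_overlap_def
proof (intro exI allI impI)
  fix t and J :: "nat set" assume J: "finite J"
  have "0 \<le> C" using order_trans[OF norm_ge_zero C] .
  define K where "K = {j\<in>J. g j t \<noteq> 0}"
  have "card K \<le> m"
    by (rule m[of K t]) (simp_all add: K_def J)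
  have "(\<Sum>j\<in>J. cmod (g j t)) = (\<Sum>j\<in>K. cmod (g j t))"
    unfolding K_def by (rule sum.mono_neutral_right) (simp_all add: J subset_iff)
  also have "\<dots> \<le> of_nat (card K) * C"
    by (rule sum_bounded_above) (rule C)
  also have "\<dots> \<le> real m * C"
    using \<open>card K \<le> m\<close> \<open>0 \<le> C\<close> by (intro mult_right_mono) simp_all
  finally show "(\<Sum>j\<in>J. cmod (g j t)) \<le> real m * C" .
qed

section \<open>A criterion for weak compactness\<close>

text \<open>
  The \<open>h j\<close> have a subsequence that converges in norm to a point of \<open>N\<close>, and the \<open>g j\<close> are a
  weakly null perturbation, so along the subsequence the sum converges weakly to that point.
\<close>

lemma sequence_meets_weakly_open:
  fixes g h :: "nat \<Rightarrow> 'a::topological_space \<Rightarrow>\<^sub>C complex"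
  assumes N: "compact N" "\<And>j. h j \<in> N" and g: "bounded_overlap (\<lambda>j. apply_bcontfun (g j))"
    and U: "openin weak_topology U" "N \<subseteq> U"
  shows "\<exists>j. h j + g j \<in> U"
proof -
  obtain l r where l: "l \<in> N" "strict_mono r" "(h \<circ> r) \<longlonglongrightarrow> l"
    using seq_compactE[of N h] N by (metis compact_eq_seq_compact_metric)
  obtain \<Phi> \<epsilon> where \<Phi>: "finite \<Phi>" "\<Phi> \<subseteq> cb_dual" "\<epsilon> > 0" "{f. \<forall>\<phi>\<in>\<Phi>. cmod (\<phi> f - \<phi> l) < \<epsilon>} \<subseteq> U"
    using openin_weak_imp_basic[OF U(1) subsetD[OF U(2) l(1)]] by (elim exE conjE)
  have "\<forall>\<^sub>F j in sequentially. cmod (\<phi> (h (r j) + g (r j)) - \<phi> l) < \<epsilon>" if "\<phi> \<in> \<Phi>" for \<phi>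
  proof -
    have \<phi>: "\<phi> \<in> cb_dual" and lin: "bounded_linear \<phi>"
      using that \<Phi>(2) by (auto simp: cb_dual_def)
    have "(\<lambda>j. \<phi> (h (r j))) \<longlonglongrightarrow> \<phi> l"
      using bounded_linear.tendsto[OF lin l(3)] by (simp add: o_def)
    moreover have "(\<lambda>j. \<phi> (g (r j))) \<longlonglongrightarrow> 0"
      using LIMSEQ_subseq_LIMSEQ[OF bounded_overlap_imp_weakly_null[OF g \<phi>] l(2)] by (simp add: o_def)
    ultimately have "(\<lambda>j. \<phi> (h (r j)) + \<phi> (g (r j))) \<longlonglongrightarrow> \<phi> l + 0"
      by (rule tendsto_add)
    moreover have "\<phi> (h (r j) + g (r j)) = \<phi> (h (r j)) + \<phi> (g (r j))" for j
      using linear_add[OF bounded_linear.linear[OF lin]] by blast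
    ultimately show ?thesis
      using \<Phi>(3) by (simp add: tendsto_iff dist_norm)
  qed
  then have "\<forall>\<^sub>F j in sequentially. \<forall>\<phi>\<in>\<Phi>. cmod (\<phi> (h (r j) + g (r j)) - \<phi> l) < \<epsilon>"
    using \<Phi>(1) by (simp add: eventually_ball_finite)
  then obtain j where "\<forall>\<phi>\<in>\<Phi>. cmod (\<phi> (h (r j) + g (r j)) - \<phi> l) < \<epsilon>"
    using eventually_happens by fastforce
  then have "h (r j) + g (r j) \<in> U"
    by (intro subsetD[OF \<Phi>(4)]) simp
  then show ?thesis ..
qed

text \<open>
  Finitely many members of an open cover already cover \<open>M\<close>.  The parameters at which \<open>F\<close> escapes
  their union lie in a compact set, for otherwise \<open>seq\<close> would produce a sequence that contradicts
  \<open>sequence_meets_weakly_open\<close>; on that compact set \<open>F\<close> has a norm compact image.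
\<close>

lemma compactin_weak_criterion:
  fixes F :: "'p::topological_space \<Rightarrow> 'a::topological_space \<Rightarrow>\<^sub>C complex"
  assumes cont: "continuous_on D F" and M: "compactin weak_topology M"
    and seq: "\<And>S. S \<subseteq> D \<Longrightarrow> \<nexists>K. compact K \<and> S \<subseteq> K \<and> K \<subseteq> D \<Longrightarrow>
      \<exists>h g N. compact N \<and> N \<subseteq> M \<and> (\<forall>j::nat. h j \<in> N) \<and>
        bounded_overlap (\<lambda>j. apply_bcontfun (g j)) \<and> (\<forall>j. h j + g j \<in> F ` S)"
  shows "compactin weak_topology (F ` D \<union> M)"
  unfolding compactin_def
proof (intro conjI allI impI)
  fix \<U> assume \<U>: "(\<forall>U\<in>\<U>. openin weak_topology U) \<and> F ` D \<union> M \<subseteq> \<Union>\<U>"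
  then have "M \<subseteq> \<Union>\<U>"
    by blast
  then obtain \<F> where \<F>: "finite \<F>" "\<F> \<subseteq> \<U>" "M \<subseteq> \<Union>\<F>"
    using M \<U> unfolding compactin_def by meson
  define S where "S = {p \<in> D. F p \<notin> \<Union>\<F>}"
  have "\<exists>K. compact K \<and> S \<subseteq> K \<and> K \<subseteq> D"
  proof (rule ccontr)
    assume "\<nexists>K. compact K \<and> S \<subseteq> K \<and> K \<subseteq> D"
    from seq[OF _ this] obtain h :: "nat \<Rightarrow> _" and g N where
      *: "compact N" "N \<subseteq> M" "\<And>j. h j \<in> N" "bounded_overlap (\<lambda>j. apply_bcontfun (g j))"
         "\<And>j. h j + g j \<in> F ` S"
      unfolding S_def by blast
    have "openin weak_topology (\<Union>\<F>)"
      using \<U> \<F> by (intro openin_Union) blast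
    then obtain j where "h j + g j \<in> \<Union>\<F>"
      using sequence_meets_weakly_open[OF *(1,3,4)] *(2) \<F>(3) by (meson order_trans)
    with *(5)[of j] show False
      by (auto simp: S_def)
  qed
  then obtain K where K: "compact K" "S \<subseteq> K" "K \<subseteq> D" by blast
  then have "compactin weak_topology (F ` K)"
    by (intro compact_imp_compactin_weak compact_continuous_image continuous_on_subset[OF cont])
  moreover have "F ` K \<subseteq> \<Union>\<U>"
    using \<U> K(3) by blast
  ultimately obtain \<G> where \<G>: "finite \<G>" "\<G> \<subseteq> \<U>" "F ` K \<subseteq> \<Union>\<G>"
    using \<U> unfolding compactin_def by meson
  have "finite (\<F> \<union> \<G>)" "\<F> \<union> \<G> \<subseteq> \<U>"
    using \<F>(1,2) \<G>(1,2) by simp_all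
  moreover have "F ` D \<union> M \<subseteq> \<Union>(\<F> \<union> \<G>)"
  proof
    fix f assume "f \<in> F ` D \<union> M"
    then show "f \<in> \<Union>(\<F> \<union> \<G>)"
    proof
      assume "f \<in> F ` D"
      then obtain p where p: "p \<in> D" "f = F p" by blast
      show ?thesis
      proof (cases "p \<in> S")
        case True
        then show ?thesis using K(2) \<G>(3) p by blast
      next
        case False
        then show ?thesis using p unfolding S_def by blast
      qed
    next
      assume "f \<in> M"
      then show ?thesis using \<F>(3) by blast
    qed
  qed
  ultimately show "\<exists>\<F>. finite \<F> \<and> \<F> \<subseteq> \<U> \<and> F ` D \<union> M \<subseteq> \<Union>\<F>"
    by blast
qed simp

section \<open>Weakly almost periodic functions and their mean\<close>

text \<open>
  The weak topology is Hausdorff, hence a weakly compact set is weakly closed and contains the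
  closure of every subset.
\<close>

lemma WAP_if_orbit_in_weakly_compact:
  assumes "compactin weak_topology A" "range (\<lambda>s. left_translate s f) \<subseteq> A"
  shows "f \<in> WAP"
proof -
  have "closedin weak_topology A"
    using assms(1) compactin_imp_closedin Hausdorff_weak by blast
  then have "weak_topology closure_of range (\<lambda>s. left_translate s f) \<subseteq> A"
    using assms(2) by (intro closure_of_minimal)
  then show ?thesis
    unfolding WAP_def using closed_compactin[OF assms(1)] by simp
qed

lemma translate_in_weak_closure:
  assumes "f \<in> WAP"
  shows "left_translate s f \<in> weak_topology closure_of range (\<lambda>s. left_translate s f)"
  using closure_of_subset[of "range (\<lambda>s. left_translate s f)" weak_topology] by auto

lemma WAP_left_translate:
  assumes "f \<in> WAP"
  shows "left_translate s f \<in> WAP"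
proof (rule WAP_if_orbit_in_weakly_compact)
  show "compactin weak_topology (weak_topology closure_of range (\<lambda>s. left_translate s f))"
    using assms by (simp add: WAP_def)
  have "left_translate t (left_translate s f) = left_translate (s + t) f" for t
    by (rule bcontfun_eqI) (simp add: add.assoc)
  then show "range (\<lambda>t. left_translate t (left_translate s f))
      \<subseteq> weak_topology closure_of range (\<lambda>s. left_translate s f)"
    using translate_in_weak_closure[OF assms] by auto
qed

lemma continuous_map_weak_add:
  "continuous_map (prod_topology weak_topology weak_topology) weak_topology
     (\<lambda>p :: ('a::topological_space \<Rightarrow>\<^sub>C complex) \<times> ('a \<Rightarrow>\<^sub>C complex). fst p + snd p)"
    (is "continuous_map ?P _ ?add")
proof -
  define \<S> where "\<S> = {\<phi> -` W | \<phi> W. \<phi> \<in> (cb_dual :: (('a \<Rightarrow>\<^sub>C complex) \<Rightarrow> complex) set) \<and> open W}"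
  have weak: "weak_topology = topology_generated_by \<S>"
    by (simp only: \<S>_def weak_topology_def)
  have "openin ?P (?add -` U \<inter> topspace ?P)" if mem: "U \<in> \<S>" for U
  proof -
    obtain \<phi> W where \<phi>: "\<phi> \<in> cb_dual" and W: "open W" and U: "U = \<phi> -` W"
      using mem unfolding \<S>_def by blast
    have c: "continuous_map weak_topology euclidean \<phi>"
      unfolding continuous_map using openin_weak_vimage[OF \<phi>] by (auto simp: vimage_def)
    have "continuous_map ?P euclidean (\<lambda>p. \<phi> (fst p) + \<phi> (snd p))"
      using continuous_map_compose[OF continuous_map_fst c] continuous_map_compose[OF continuous_map_snd c]
      by (intro continuous_map_add) (simp_all only: o_def)
    then have "openin ?P {p \<in> topspace ?P. \<phi> (fst p) + \<phi> (snd p) \<in> W}"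
      by (rule openin_continuous_map_preimage) (use W in simp)
    moreover have "\<phi> (f + g) = \<phi> f + \<phi> g" for f g
      using \<phi> linear_add[OF bounded_linear.linear, of \<phi> f g] unfolding cb_dual_def by blast
    then have "{p \<in> topspace ?P. \<phi> (fst p) + \<phi> (snd p) \<in> W} = ?add -` U \<inter> topspace ?P"
      unfolding U by auto
    ultimately show ?thesis
      by simp
  qed
  moreover have "\<Union>\<S> = UNIV"
    by (metis weak topspace_weak topology_generated_by_topspace)
  then have "?add ` topspace ?P \<subseteq> \<Union>\<S>"
    by (simp only: subset_UNIV)
  ultimately show ?thesis
    unfolding weak[symmetric] by (subst (3) weak) (rule continuous_on_generated_topo)
qed

lemma WAP_add:
  assumes "f \<in> WAP" "g \<in> WAP"
  shows "f + g \<in> WAP"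
proof (rule WAP_if_orbit_in_weakly_compact)
  let ?A = "\<lambda>f. weak_topology closure_of range (\<lambda>s. left_translate s f)"
  let ?add = "\<lambda>p :: ('a \<Rightarrow>\<^sub>C complex) \<times> ('a \<Rightarrow>\<^sub>C complex). fst p + snd p"
  have "compactin (prod_topology weak_topology weak_topology) (?A f \<times> ?A g)"
    using assms by (simp add: WAP_def compactin_Times)
  then show "compactin weak_topology (?add ` (?A f \<times> ?A g))"
    by (rule image_compactin) (rule continuous_map_weak_add)
  have "left_translate s (f + g) = left_translate s f + left_translate s g" for s
    by (rule bcontfun_eqI) simp
  then show "range (\<lambda>s. left_translate s (f + g)) \<subseteq> ?add ` (?A f \<times> ?A g)"
    by (auto intro!: image_eqI[of _ _ "(_, _)"] translate_in_weak_closure assms)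
qed

lemma zero_in_WAP: "0 \<in> WAP"
proof (rule WAP_if_orbit_in_weakly_compact)
  show "compactin weak_topology {0}"
    by (intro finite_imp_compactin) auto
  show "range (\<lambda>s. left_translate s 0) \<subseteq> {0}"
    by (auto intro: bcontfun_eqI)
qed

text \<open>
  By invariance the sum of the first \<open>n\<close> remainders (translate of \<open>f\<close> minus \<open>h j\<close>) has mean
  \<open>n * \<mu> f\<close>, but its norm is bounded independently of \<open>n\<close>.
\<close>

lemma mean_zero_if_bounded_overlap:
  fixes f :: "'a::topological_group_add \<Rightarrow>\<^sub>C complex"
  assumes \<mu>: "invariant_mean_WAP \<mu>" and f: "f \<in> WAP"
    and h: "\<And>j::nat. h j \<in> WAP" "\<And>j. \<mu> (h j) = 0"
    and g: "bounded_overlap (\<lambda>j t. apply_bcontfun f (s j + t) - apply_bcontfun (h j) t)"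
    and minus: "\<And>j. - h j \<in> WAP"
  shows "\<mu> f = 0"
proof -
  have add: "\<mu> (u + v) = \<mu> u + \<mu> v" if "u \<in> WAP" "v \<in> WAP" for u v
    using \<mu> that by (simp add: invariant_mean_WAP_def)
  have contr: "cmod (\<mu> u) \<le> norm u" and inv: "\<mu> (left_translate r u) = \<mu> u" if "u \<in> WAP" for u r
    using \<mu> that by (auto simp: invariant_mean_WAP_def)
  have zero: "\<mu> 0 = 0"
    using add[OF zero_in_WAP zero_in_WAP] by simp
  define G where "G j = left_translate (s j) f + - h j" for j
  have G: "G j \<in> WAP" for j
    unfolding G_def by (intro WAP_add WAP_left_translate f minus)
  have "\<mu> (- h j) = 0" for j
    using add[OF h(1) minus, of j j] h(2)[of j] zero by simp
  then have \<mu>G: "\<mu> (G j) = \<mu> f" for j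
    unfolding G_def by (simp del: add_uminus_conv_diff add: add[OF WAP_left_translate[OF f] minus] inv[OF f])
  have sum: "(\<Sum>j<n. G j) \<in> WAP \<and> \<mu> (\<Sum>j<n. G j) = of_nat n * \<mu> f" for n
    by (induction n) (simp_all add: zero_in_WAP zero WAP_add G add \<mu>G algebra_simps)
  obtain B where B: "\<And>t J. finite J \<Longrightarrow> (\<Sum>j\<in>J. cmod (f (s j + t) - h j t)) \<le> B"
    using g unfolding bounded_overlap_def by blast
  have bound: "real n * cmod (\<mu> f) \<le> B" for n
  proof -
    have "norm (\<Sum>j<n. G j) \<le> B"
    proof (rule norm_bound)
      fix t
      have "norm ((\<Sum>j<n. G j) t) \<le> (\<Sum>j<n. cmod (f (s j + t) - h j t))"
        unfolding sum_apply_bcontfun G_def by (auto intro: order_trans[OF norm_sum])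
      also have "\<dots> \<le> B" by (rule B) simp
      finally show "norm ((\<Sum>j<n. G j) t) \<le> B" .
    qed
    moreover have "real n * cmod (\<mu> f) = cmod (\<mu> (\<Sum>j<n. G j))"
      using sum[of n] by (simp add: norm_mult)
    ultimately show ?thesis
      using contr[of "\<Sum>j<n. G j"] sum[of n] by linarith
  qed
  show ?thesis
  proof (rule ccontr)
    assume "\<mu> f \<noteq> 0"
    then obtain n where "B < real n * cmod (\<mu> f)"
      using reals_Archimedean3[of "cmod (\<mu> f)"] by auto
    with bound[of n] show False by simp
  qed
qed

section \<open>Uniform continuity and neighbourhoods in topological groups\<close>

text \<open>
  Uniform continuity with respect to perturbations on the left of the argument, the side on which
  \<open>left_translate\<close> acts.
\<close>

definition left_uniformly_continuous :: "('a::topological_group_add \<Rightarrow> complex) \<Rightarrow> bool" where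
  "left_uniformly_continuous F \<longleftrightarrow>
     (\<forall>\<epsilon>>0. \<exists>U. open U \<and> 0 \<in> U \<and> (\<forall>u\<in>U. \<forall>t. dist (F (u + t)) (F t) < \<epsilon>))"

lemma right_translated_nbhd:
  fixes s :: "'a::topological_group_add"
  assumes "open U" "0 \<in> U"
  shows "\<forall>\<^sub>F s' in nhds s. s' - s \<in> U"
proof -
  have "((\<lambda>s'. s' - s) \<longlongrightarrow> s - s) (nhds s)"
    by (intro tendsto_diff tendsto_const filterlim_ident)
  then show ?thesis
    using assms topological_tendstoD by fastforce
qed

lemma left_uniformly_continuous_imp_continuous:
  assumes "left_uniformly_continuous F"
  shows "continuous_on UNIV F"
  unfolding continuous_on_def
proof
  fix s
  have "(F \<longlongrightarrow> F s) (nhds s)"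
  proof (rule tendstoI)
    fix \<epsilon> :: real assume "\<epsilon> > 0"
    then obtain U where U: "open U" "0 \<in> U" "\<And>u t. u \<in> U \<Longrightarrow> dist (F (u + t)) (F t) < \<epsilon>"
      using assms unfolding left_uniformly_continuous_def by meson
    show "\<forall>\<^sub>F s' in nhds s. dist (F s') (F s) < \<epsilon>"
      using right_translated_nbhd[OF U(1,2)]
    proof (rule eventually_mono)
      fix s' assume "s' - s \<in> U"
      then show "dist (F s') (F s) < \<epsilon>"
        using U(3)[of "s' - s" s] by simp
    qed
  qed
  then show "(F \<longlongrightarrow> F s) (at s within UNIV)"
    by (rule tendsto_mono[OF at_within_le_nhds])
qed

lemma continuous_on_left_translate:
  fixes f :: "'a::topological_group_add \<Rightarrow>\<^sub>C complex"
  assumes "left_uniformly_continuous (apply_bcontfun f)"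
  shows "continuous_on UNIV (\<lambda>s. left_translate s f)"
  unfolding continuous_on_def
proof
  fix s
  have "((\<lambda>s. left_translate s f) \<longlongrightarrow> left_translate s f) (nhds s)"
  proof (rule tendstoI)
    fix \<epsilon> :: real assume "\<epsilon> > 0"
    then obtain U where U: "open U" "0 \<in> U" "\<And>u t. u \<in> U \<Longrightarrow> dist (f (u + t)) (f t) < \<epsilon> / 2"
      using assms unfolding left_uniformly_continuous_def by (meson half_gt_zero)
    show "\<forall>\<^sub>F s' in nhds s. dist (left_translate s' f) (left_translate s f) < \<epsilon>"
      using right_translated_nbhd[OF U(1,2)]
    proof (rule eventually_mono)
      fix s' assume s': "s' - s \<in> U"
      have "dist (left_translate s' f) (left_translate s f) \<le> \<epsilon> / 2"
      proof (rule dist_bound)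
        fix t
        have "dist (f (s' - s + (s + t))) (f (s + t)) < \<epsilon> / 2"
          by (rule U(3)[OF s'])
        also have "s' - s + (s + t) = s' + t"
          by (metis add.assoc diff_add_cancel)
        finally show "dist (left_translate s' f t) (left_translate s f t) \<le> \<epsilon> / 2"
          by simp
      qed
      with \<open>\<epsilon> > 0\<close> show "dist (left_translate s' f) (left_translate s f) < \<epsilon>"
        by simp
    qed
  qed
  then show "((\<lambda>s. left_translate s f) \<longlongrightarrow> left_translate s f) (at s within UNIV)"
    by (rule tendsto_mono[OF at_within_le_nhds])
qed

lemma compact_right_translate: "compact K \<Longrightarrow> compact ((\<lambda>w. w + a) ` K)" for a :: "'a::topological_group_add"
  by (intro compact_continuous_image continuous_intros)

lemma compact_left_translate: "compact K \<Longrightarrow> compact ((\<lambda>w. a + w) ` K)" for a :: "'a::topological_group_add"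
  by (intro compact_continuous_image continuous_intros)

lemma symmetric_halving_nbhd:
  fixes U :: "'a::topological_group_add set"
  assumes "open U" "0 \<in> U"
  obtains N where "open N" "0 \<in> N" "\<And>a. a \<in> N \<Longrightarrow> - a \<in> N" "\<And>a b. a \<in> N \<Longrightarrow> b \<in> N \<Longrightarrow> a + b \<in> U"
proof -
  have "open ((\<lambda>p :: 'a \<times> 'a. fst p + snd p) -` U)"
    by (intro open_vimage assms continuous_intros)
  then obtain A B where AB: "open A" "open B" "(0, 0) \<in> A \<times> B"
      "A \<times> B \<subseteq> (\<lambda>p :: 'a \<times> 'a. fst p + snd p) -` U"
    using assms(2) by (elim open_prod_elim[where x = "(0, 0)"]) auto
  define N where "N = A \<inter> B \<inter> uminus -` (A \<inter> B)"
  have "open N"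
    unfolding N_def using AB by (intro open_Int open_vimage continuous_intros)
  moreover have "0 \<in> N" "\<And>a. a \<in> N \<Longrightarrow> - a \<in> N"
    using AB(3) by (auto simp: N_def)
  moreover have "a + b \<in> U" if "a \<in> N" "b \<in> N" for a b
    using that subsetD[OF AB(4), of "(a, b)"] by (auto simp: N_def)
  ultimately show thesis
    using that by blast
qed

text \<open>
  The closure of a neighbourhood \<open>N\<close> is contained in \<open>N + N\<close> when \<open>N\<close> is symmetric, which
  keeps it inside a prescribed neighbourhood.
\<close>

lemma compact_symmetric_nbhd:
  fixes U :: "'a::{topological_group_add, t2_space} set"
  assumes lc: "locally_compact_space (euclidean :: 'a topology)" and U: "open U" "0 \<in> U"
  obtains P where "compact P" "0 \<in> interior P" "P \<subseteq> U" "\<And>p. p \<in> P \<Longrightarrow> - p \<in> P"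
proof -
  have "\<exists>A K. openin euclidean A \<and> compactin euclidean K \<and> (0 :: 'a) \<in> A \<and> A \<subseteq> K"
    using lc unfolding locally_compact_space_def by (rule bspec) simp
  then obtain A K :: "'a set" where AK: "open A" "compact K" "0 \<in> A" "A \<subseteq> K"
    unfolding compactin_euclidean_iff open_openin[symmetric] by (elim exE conjE)
  obtain N where N: "open N" "0 \<in> N" "\<And>a. a \<in> N \<Longrightarrow> - a \<in> N" "\<And>a b. a \<in> N \<Longrightarrow> b \<in> N \<Longrightarrow> a + b \<in> U \<inter> A"
    using symmetric_halving_nbhd[of "U \<inter> A"] U AK by (metis IntI open_Int)
  have sub: "closure N \<subseteq> U \<inter> A"
  proof
    fix y assume y: "y \<in> closure N"
    have "open ((\<lambda>z. z - y) -` N)"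
      using N(1) by (intro open_vimage continuous_intros)
    moreover have "y \<in> (\<lambda>z. z - y) -` N \<inter> closure N"
      using N(2) y by simp
    ultimately have "(\<lambda>z. z - y) -` N \<inter> N \<noteq> {}"
      by (metis open_Int_closure_eq_empty empty_iff)
    then obtain z where z: "z \<in> N" "z - y \<in> N"
      by auto
    have "y = - (z - y) + z"
      by simp
    then show "y \<in> U \<inter> A"
      using N(3)[OF z(2)] N(4) z(1) by metis
  qed
  have "- y \<in> closure N" if "y \<in> closure N" for y
  proof -
    have "uminus ` closure N \<subseteq> closure N"
      by (rule image_closure_subset)
         (use N(3) closure_subset in \<open>auto intro!: continuous_intros\<close>)
    then show ?thesis using that by blast
  qed
  moreover have "K \<inter> closure N = closure N"
    using sub AK(4) by blast
  then have "compact (closure N)"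
    using compact_Int_closed[OF AK(2) closed_closure, of N] by simp
  moreover have "0 \<in> interior (closure N)"
    using interior_maximal[OF closure_subset N(1)] N(2) by blast
  ultimately show thesis
    using sub by (intro that[of "closure N"]) simp_all
qed

text \<open>
  Complete regularity of locally compact Hausdorff spaces supplies the bump.  Its support is
  relatively compact, so the tube lemma makes its continuity uniform.
\<close>

lemma uniformly_continuous_bump:
  fixes V P :: "'a::{topological_group_add, t2_space} set"
  assumes lc: "locally_compact_space (euclidean :: 'a topology)"
    and V: "open V" "0 \<in> V" "\<And>a. a \<in> V \<Longrightarrow> - a \<in> V"
    and P: "compact P" "\<And>u v. u \<in> V \<Longrightarrow> v \<in> V \<Longrightarrow> u + v \<in> P"
  obtains b :: "'a \<Rightarrow>\<^sub>C complex"
  where "b 0 = 1" "\<And>t. b t \<noteq> 0 \<Longrightarrow> t \<in> V" "\<And>t. b t = complex_of_real (cmod (b t))"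
    "\<And>t. cmod (b t) \<le> 1" "left_uniformly_continuous (apply_bcontfun b)"
proof -
  have "Hausdorff_space (euclidean :: 'a topology)"
    unfolding Hausdorff_space_def disjnt_def open_openin[symmetric] by (metis hausdorff)
  then have "completely_regular_space (euclidean :: 'a topology)"
    using lc by (intro locally_compact_regular_imp_completely_regular_space disjI1)
  moreover have "closedin euclidean (- V)" "0 \<in> topspace euclidean - (- V)"
    using V by auto
  ultimately obtain f :: "'a \<Rightarrow> real" where
    f: "continuous_map euclidean (top_of_set {0..1}) f" "f 0 = 0" "f ` (- V) \<subseteq> {1}"
    unfolding completely_regular_space_def by meson
  have cont: "continuous_on UNIV f" and f01: "\<And>t. 0 \<le> f t \<and> f t \<le> 1"
    using f(1) by (auto simp: continuous_map_in_subtopology)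
  define B where "B t = complex_of_real (1 - f t)" for t
  have contB: "continuous_on UNIV B"
    unfolding B_def using cont by (intro continuous_intros)
  have BV: "t \<in> V" if "B t \<noteq> 0" for t
    using that f(3) by (auto simp: B_def)
  have normB: "cmod (B t) = 1 - f t" for t
    using f01[of t] unfolding B_def norm_of_real by simp
  have luc: "left_uniformly_continuous B"
    unfolding left_uniformly_continuous_def
  proof (intro allI impI)
    fix \<epsilon> :: real assume "\<epsilon> > 0"
    define W where "W = {p :: 'a \<times> 'a. dist (B (fst p + snd p)) (B (snd p)) < \<epsilon>}"
    have W: "open W"
      unfolding W_def
      by (intro open_Collect_less continuous_intros continuous_on_compose2[OF contB]) auto
    have sub: "{0} \<times> P \<subseteq> W"
      using \<open>\<epsilon> > 0\<close> by (auto simp: W_def)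
    obtain U where U: "0 \<in> U" "open U" "U \<times> P \<subseteq> W"
      using Elementary_Topology.tube_lemma[OF P(1) W sub] by (elim exE conjE)
    have "dist (B (u + t)) (B t) < \<epsilon>" if u: "u \<in> U \<inter> V" for u t
    proof (cases "t \<in> P")
      case True
      then show ?thesis using U(3) u by (auto simp: W_def)
    next
      case False
      then have "t \<notin> V"
        using P(2)[OF V(2)] by auto
      moreover have "u + t \<notin> V"
      proof
        assume "u + t \<in> V"
        then have "- u + (u + t) \<in> P"
          using u V(3) by (intro P(2)) auto
        with False show False by (simp add: add.assoc[symmetric])
      qed
      ultimately show ?thesis
        using BV \<open>\<epsilon> > 0\<close> by (metis dist_self)
    qed
    then show "\<exists>U. open U \<and> 0 \<in> U \<and> (\<forall>u\<in>U. \<forall>t. dist (B (u + t)) (B t) < \<epsilon>)"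
      using U V by (intro exI[of _ "U \<inter> V"]) auto
  qed
  have "B \<in> bcontfun"
    using contB f01 normB unfolding bcontfun_def bounded_iff by (auto intro!: exI[of _ 1])
  then obtain b :: "'a \<Rightarrow>\<^sub>C complex" where b: "B = apply_bcontfun b"
    by (rule bcontfunE)
  show thesis
  proof (rule that[of b])
    show "b 0 = 1" using f(2) by (simp add: b[symmetric] B_def)
    show "\<And>t. b t \<noteq> 0 \<Longrightarrow> t \<in> V" using BV by (simp add: b)
    show "\<And>t. b t = complex_of_real (cmod (b t))"
      unfolding b[symmetric] normB by (simp add: B_def)
    show "\<And>t. cmod (b t) \<le> 1"
      unfolding b[symmetric] normB using f01 by simp
    show "left_uniformly_continuous (apply_bcontfun b)"
      using luc unfolding b .
  qed
qed

text \<open>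
  Each step only has to leave a compact set that depends on the earlier terms, and \<open>S\<close> is contained
  in none.
\<close>

lemma sequence_avoiding_compacts:
  fixes S :: "'a::topological_space set"
  assumes S: "\<nexists>K. compact K \<and> S \<subseteq> K" and B: "\<And>F. finite F \<Longrightarrow> compact (B F)"
  shows "\<exists>s :: nat \<Rightarrow> 'a. \<forall>n. s n \<in> S \<and> s n \<notin> B (s ` {..<n})"
proof (rule dependent_wf_choice[OF wf_less, where P = "\<lambda>s n r. r \<in> S \<and> r \<notin> B (s ` {..<n})"])
  fix f g :: "nat \<Rightarrow> 'a" and n r
  assume "\<And>z. (z, n) \<in> {(x, y). x < y} \<Longrightarrow> f z = g z"
  then have "f ` {..<n} = g ` {..<n}"
    by (intro image_cong) auto
  then show "(r \<in> S \<and> r \<notin> B (f ` {..<n})) = (r \<in> S \<and> r \<notin> B (g ` {..<n}))"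
    by simp
next
  fix n and f :: "nat \<Rightarrow> 'a"
  show "\<exists>r. r \<in> S \<and> r \<notin> B (f ` {..<n})"
    using S B[of "f ` {..<n}"] by blast
qed

section \<open>Free sequences in E-sets\<close>

text \<open>
  Both conjugations are available because the intersection in the definition of an E-set runs over
  \<open>X\<close> and over the inverses of its elements.
\<close>

lemma E_set_conjugation_nbhd:
  fixes X :: "'a::topological_group_add set"
  assumes "E_set X" "open U" "0 \<in> U"
  obtains N where "open N" "0 \<in> N" "\<And>u x. u \<in> N \<Longrightarrow> x \<in> X \<Longrightarrow> - x + u + x \<in> U"
    "\<And>u x. u \<in> N \<Longrightarrow> x \<in> X \<Longrightarrow> x + u - x \<in> U"
proof -
  define Z where "Z = (\<Inter>x\<in>X \<union> uminus ` X. (\<lambda>u. - x + u + x) ` U)"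
  have "0 \<in> interior Z"
    using assms unfolding E_set_def Z_def by (simp add: interior_open)
  moreover have "- x + u + x \<in> U" "x + u - x \<in> U" if u: "u \<in> interior Z" and x: "x \<in> X" for u x
  proof -
    have Z: "u \<in> Z"
      using u interior_subset by blast
    then have "u \<in> (\<lambda>u. - (- x) + u + - x) ` U"
      unfolding Z_def using x by blast
    then show "- x + u + x \<in> U"
      by (auto simp: add.assoc diff_conv_add_uminus simp del: add_uminus_conv_diff)
    have "u \<in> (\<lambda>u. - x + u + x) ` U"
      using Z unfolding Z_def using x by blast
    then show "x + u - x \<in> U"
      by (auto simp: add.assoc diff_conv_add_uminus simp del: add_uminus_conv_diff)
  qed
  ultimately show thesis
    using that[of "interior Z"] by blast
qed

text \<open>
  A finite union of compact sets is compact and closed, so it would contain the closure of \<open>X\<close>.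
\<close>

lemma infinite_covering_number:
  fixes X :: "'a::t2_space set"
  assumes \<kappa>: "is_compact_covering_number X \<kappa>" and X: "\<not> compact (closure X)"
  shows "infinite (Field \<kappa>)"
proof
  assume fin: "finite (Field \<kappa>)"
  have "Card_order \<kappa>"
    using \<kappa> unfolding is_compact_covering_number_def by blast
  obtain \<C> where \<C>: "compact_cover X \<C>" "|\<C>| =o \<kappa>"
    using \<kappa> unfolding is_compact_covering_number_def by blast
  have "|\<C>| =o |Field \<kappa>|"
    using \<C>(2) card_of_Field_ordIso[OF \<open>Card_order \<kappa>\<close>] ordIso_symmetric ordIso_transitive by blast
  then have "finite \<C>"
    using fin card_of_ordIso_finite by blast
  then have "compact (\<Union>\<C>)"
    using \<C>(1) unfolding compact_cover_def by (intro compact_Union) simp_all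
  moreover have "closure X \<subseteq> \<Union>\<C>"
    using \<C>(1) \<open>compact (\<Union>\<C>)\<close> unfolding compact_cover_def
    by (intro closure_minimal compact_imp_closed) simp_all
  ultimately have "compact (closure X)"
    using compact_Int_closed[of "\<Union>\<C>" "closure X"] by (simp add: Int_absorb1)
  with X show False ..
qed

lemma not_covered_by_fewer_compacts:
  assumes "is_compact_covering_number X \<kappa>" "\<And>K. K \<in> \<C> \<Longrightarrow> compact K" "|\<C>| <o \<kappa>"
  obtains z where "z \<in> X" "z \<notin> \<Union>\<C>"
proof -
  have "\<not> compact_cover X \<C>"
    using assms(1,3) not_ordLess_ordLeq unfolding is_compact_covering_number_def by blast
  then show thesis
    using that assms(2) unfolding compact_cover_def by blast
qed

lemma card_of_triples_less:
  assumes "Card_order \<kappa>" "infinite (Field \<kappa>)" "|U| <o \<kappa>"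
  shows "|U \<times> U \<times> U| <o \<kappa>"
proof (cases "finite U")
  case True
  then show ?thesis
    by (intro finite_ordLess_infinite card_of_Well_order card_order_on_well_order_on[OF assms(1)])
       (simp_all add: Field_card_of assms(2))
next
  case False
  have "|U \<times> U \<times> U| \<le>o |U|"
    by (intro card_of_Sigma_ordLeq_infinite ballI False card_of_mono1 subset_refl)
  then show ?thesis
    using assms(3) ordLeq_ordLess_trans by blast
qed

text \<open>
  For fixed earlier indices \<open>j, k, l\<close> the forbidden values of \<open>x i\<close> form a continuous image of
  \<open>P \<times> P\<close>.  There are fewer than \<open>\<kappa>\<close> such triples, and fewer than \<open>\<kappa>\<close> compact sets do not cover \<open>X\<close>.
\<close>

lemma transfinite_free_sequence:
  fixes X :: "'a::{topological_group_add, t2_space} set" and \<kappa> :: "'k rel"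
  assumes \<kappa>: "is_compact_covering_number X \<kappa>" and inf: "infinite (Field \<kappa>)" and P: "compact P"
  shows "\<exists>x. \<forall>i\<in>Field \<kappa>. x i \<in> X \<and>
    (\<forall>j\<in>underS \<kappa> i. \<forall>k\<in>underS \<kappa> i. \<forall>l\<in>underS \<kappa> i. \<forall>p\<in>P. \<forall>q\<in>P.
      x i \<noteq> x j + p - x k + x l + q)"
proof -
  have co: "Card_order \<kappa>"
    using \<kappa> unfolding is_compact_covering_number_def by blast
  then have wf: "wf (\<kappa> - Id)"
    using card_order_on_well_order_on well_order_on_def by blast
  define good where "good x i r \<longleftrightarrow> (i \<in> Field \<kappa> \<longrightarrow> r \<in> X \<and>
    (\<forall>j\<in>underS \<kappa> i. \<forall>k\<in>underS \<kappa> i. \<forall>l\<in>underS \<kappa> i. \<forall>p\<in>P. \<forall>q\<in>P.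
      r \<noteq> x j + p - x k + x l + q))" for x :: "'k \<Rightarrow> 'a" and i r
  have "\<exists>x. \<forall>i. good x i (x i)"
  proof (rule dependent_wf_choice[OF wf])
    fix f g :: "'k \<Rightarrow> 'a" and i r
    assume fg: "\<And>z. (z, i) \<in> \<kappa> - Id \<Longrightarrow> f z = g z"
    have "f j = g j" if "j \<in> underS \<kappa> i" for j
      using that by (intro fg) (simp add: underS_def)
    then show "good f i r = good g i r"
      unfolding good_def by simp
  next
    fix i and f :: "'k \<Rightarrow> 'a"
    show "\<exists>r. good f i r"
    proof (cases "i \<in> Field \<kappa>")
      case True
      define K where "K = (\<lambda>(j, k, l). (\<lambda>(p, q). f j + p - f k + f l + q) ` (P \<times> P))"
      define \<C> where "\<C> = K ` (underS \<kappa> i \<times> underS \<kappa> i \<times> underS \<kappa> i)"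
      have "compact (K (j, k, l))" for j k l
        unfolding K_def prod.case case_prod_unfold
        by (intro compact_continuous_image compact_Times P continuous_intros)
      then have "compact L" if "L \<in> \<C>" for L
        using that unfolding \<C>_def by auto
      moreover have "|\<C>| <o \<kappa>"
        unfolding \<C>_def using card_of_triples_less[OF co inf card_of_underS[OF co True]]
          card_of_image ordLeq_ordLess_trans by blast
      ultimately obtain z where z: "z \<in> X" "z \<notin> \<Union>\<C>"
        using not_covered_by_fewer_compacts[OF \<kappa>] by blast
      have "z \<noteq> f j + p - f k + f l + q"
        if "j \<in> underS \<kappa> i" "k \<in> underS \<kappa> i" "l \<in> underS \<kappa> i" "p \<in> P" "q \<in> P" for j k l p q
      proof
        assume "z = f j + p - f k + f l + q"
        then have "z \<in> K (j, k, l)"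
          unfolding K_def prod.case using that by (intro image_eqI[of _ _ "(p, q)"]) simp_all
        moreover have "K (j, k, l) \<in> \<C>"
          unfolding \<C>_def using that by (intro imageI) simp
        ultimately show False
          using z(2) by blast
      qed
      then show ?thesis
        unfolding good_def using z(1) by blast
    qed (simp add: good_def)
  qed
  then show ?thesis
    unfolding good_def by blast
qed

text \<open>
  In a possibly non-commutative group the equation can be solved for the outer terms of the left-hand side so
  that the solution has the form occurring in \<open>transfinite_free_sequence\<close>; by symmetry of the
  equation this covers all four terms.
\<close>

lemma group_equation_solve:
  fixes a b c d p q :: "'a::group_add"
  assumes "a + p - b = c + q - d"
  shows "a = c + q - d + b + - p" "b = d + - q - c + a + p"
proof -
  have "a + p = c + q - d + b"
    using assms by (simp only: diff_eq_eq)
  then show "a = c + q - d + b + - p"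
    by (simp add: eq_diff_eq)
  have "- (a + p - b) = - (c + q - d)"
    using assms by (rule arg_cong)
  then have "b - (a + p) = d - (c + q)"
    by (simp only: minus_diff_eq)
  then have "b = d - (c + q) + (a + p)"
    by (simp only: diff_eq_eq)
  then show "b = d + - q - c + a + p"
    by (simp add: add.assoc minus_add diff_conv_add_uminus del: add_uminus_conv_diff)
qed

text \<open>
  Among the indices of a forbidden equation the largest one occurs once, so solving for it
  expresses its point by earlier ones in a way excluded at its choice.
\<close>

lemma free_imp_sidon:
  fixes x :: "'k \<Rightarrow> 'a::group_add" and \<kappa> :: "'k rel"
  assumes wo: "Well_order \<kappa>" and P_zero: "0 \<in> P" and P_minus: "\<And>p. p \<in> P \<Longrightarrow> - p \<in> P"
    and free: "\<And>i j k l p q. \<lbrakk>i \<in> Field \<kappa>; j \<in> underS \<kappa> i; k \<in> underS \<kappa> i; l \<in> underS \<kappa> i; p \<in> P; q \<in> P\<rbrakk> \<Longrightarrow>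
      x i \<noteq> x j + p - x k + x l + q"
  shows "\<lbrakk>i \<in> Field \<kappa>; j \<in> Field \<kappa>; i \<noteq> j; p \<in> P; q \<in> P\<rbrakk> \<Longrightarrow> x i \<noteq> x j + p + q"
    and "\<lbrakk>i \<in> Field \<kappa>; j \<in> Field \<kappa>; k \<in> Field \<kappa>; l \<in> Field \<kappa>; distinct [i, j, k, l]; p \<in> P; q \<in> P\<rbrakk> \<Longrightarrow>
      x i + p - x j \<noteq> x k + q - x l"
proof -
  have lin: "Linear_order \<kappa>"
    using wo by (simp add: well_order_on_def)
  then have tot: "i \<in> underS \<kappa> j \<or> j \<in> underS \<kappa> i" if "i \<in> Field \<kappa>" "j \<in> Field \<kappa>" "i \<noteq> j" for i j
    using that unfolding underS_def linear_order_on_def total_on_def by blast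
  have tr: "i \<in> underS \<kappa> k" if "i \<in> underS \<kappa> j" "j \<in> underS \<kappa> k" for i j k
    using that lin unfolding underS_def linear_order_on_def partial_order_on_def preorder_on_def
    by (auto dest: transD antisymD)
  show "x i \<noteq> x j + p + q" if ij: "i \<in> Field \<kappa>" "j \<in> Field \<kappa>" "i \<noteq> j" and pq: "p \<in> P" "q \<in> P"
  proof
    assume eq: "x i = x j + p + q"
    from tot[OF ij] show False
    proof
      assume j: "i \<in> underS \<kappa> j"
      have "x j = x i + - q - x i + x i + - p"
        unfolding eq by (simp add: add.assoc minus_add diff_conv_add_uminus del: add_uminus_conv_diff)
      then show False
        using free[OF ij(2) j j j P_minus[OF pq(2)] P_minus[OF pq(1)]] by blast
    next
      assume i: "j \<in> underS \<kappa> i"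
      have "x i = x j + p - x j + x j + q"
        unfolding eq by (simp add: add.assoc)
      then show False
        using free[OF ij(1) i i i pq] by blast
    qed
  qed
  show "x i + p - x j \<noteq> x k + q - x l"
    if F: "i \<in> Field \<kappa>" "j \<in> Field \<kappa>" "k \<in> Field \<kappa>" "l \<in> Field \<kappa>" and d: "distinct [i, j, k, l]"
      and pq: "p \<in> P" "q \<in> P"
  proof
    assume eq: "x i + p - x j = x k + q - x l"
    have "(j \<in> underS \<kappa> i \<and> k \<in> underS \<kappa> i \<and> l \<in> underS \<kappa> i) \<or>
        (i \<in> underS \<kappa> j \<and> k \<in> underS \<kappa> j \<and> l \<in> underS \<kappa> j) \<or>
        (i \<in> underS \<kappa> k \<and> j \<in> underS \<kappa> k \<and> l \<in> underS \<kappa> k) \<or>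
        (i \<in> underS \<kappa> l \<and> j \<in> underS \<kappa> l \<and> k \<in> underS \<kappa> l)"
    proof -
      have "i \<noteq> j" "i \<noteq> k" "i \<noteq> l" "j \<noteq> k" "j \<noteq> l" "k \<noteq> l"
        using d by auto
      then show ?thesis
        using tot[OF F(1,2)] tot[OF F(1,3)] tot[OF F(1,4)] tot[OF F(2,3)] tot[OF F(2,4)] tot[OF F(3,4)]
        by (meson tr)
    qed
    then show False
    proof (elim disjE conjE)
      assume "j \<in> underS \<kappa> i" "k \<in> underS \<kappa> i" "l \<in> underS \<kappa> i"
      then show False
        using free[OF F(1) _ _ _ pq(2) P_minus[OF pq(1)]] group_equation_solve(1)[OF eq] by blast
    next
      assume "i \<in> underS \<kappa> j" "k \<in> underS \<kappa> j" "l \<in> underS \<kappa> j"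
      then show False
        using free[OF F(2) _ _ _ P_minus[OF pq(2)] pq(1)] group_equation_solve(2)[OF eq] by blast
    next
      assume "i \<in> underS \<kappa> k" "j \<in> underS \<kappa> k" "l \<in> underS \<kappa> k"
      then show False
        using free[OF F(3) _ _ _ pq(1) P_minus[OF pq(2)]] group_equation_solve(1)[OF eq[symmetric]] by blast
    next
      assume "i \<in> underS \<kappa> l" "j \<in> underS \<kappa> l" "k \<in> underS \<kappa> l"
      then show False
        using free[OF F(4) _ _ _ P_minus[OF pq(1)] pq(2)] group_equation_solve(2)[OF eq[symmetric]] by blast
    qed
  qed
qed

section \<open>Sums of bumps along a Sidon set\<close>

lemma group_shift_difference:
  fixes s t :: "'a::group_add"
  assumes "s + t = a + u" "s' + t = b + v"
  shows "s - s' = a + (u - v) - b"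
proof -
  have "s - s' = (s + t) - (s' + t)"
    by (simp add: diff_conv_add_uminus minus_add add.assoc del: add_uminus_conv_diff)
  also have "\<dots> = a + (u - v) - b"
    unfolding assms by (simp add: diff_conv_add_uminus minus_add add.assoc del: add_uminus_conv_diff)
  finally show ?thesis .
qed

text \<open>
  The points \<open>x i\<close> form a Sidon set modulo the compact neighbourhood \<open>P\<close>.  Conjugating \<open>P\<close> by them
  stays in the compact set \<open>W\<close>, and conjugating small neighbourhoods gives uniformly small sets; these
  two conditions come from the E-set.  The bump \<open>b\<close> lives on \<open>V\<close>, of which the fourfold sum fits
  into \<open>P\<close>, so that differences of two elements of \<open>V + V\<close> are covered by the Sidon condition.
\<close>

locale sidon_bumps =
  fixes x :: "'k \<Rightarrow> 'a::{topological_group_add, t2_space}" and I :: "'k set"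
    and V P W :: "'a set" and b :: "'a \<Rightarrow>\<^sub>C complex"
  assumes V_open: "open V" and V_zero: "0 \<in> V" and V_minus: "\<And>a. a \<in> V \<Longrightarrow> - a \<in> V"
    and V_sum: "\<And>a b c d. a \<in> V \<Longrightarrow> b \<in> V \<Longrightarrow> c \<in> V \<Longrightarrow> d \<in> V \<Longrightarrow> a + b + c + d \<in> P"
    and P_compact: "compact P" and P_minus: "\<And>p. p \<in> P \<Longrightarrow> - p \<in> P"
    and W_compact: "compact W"
    and conj_W: "\<And>i p. i \<in> I \<Longrightarrow> p \<in> P \<Longrightarrow> x i + p - x i \<in> W"
    and conj_nbhd: "\<And>U. open U \<Longrightarrow> 0 \<in> U \<Longrightarrow>
      \<exists>U'. open U' \<and> 0 \<in> U' \<and> (\<forall>u\<in>U'. \<forall>i\<in>I. - x i + u + x i \<in> U)"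
    and separated: "\<And>i j p q. \<lbrakk>i \<in> I; j \<in> I; i \<noteq> j; p \<in> P; q \<in> P\<rbrakk> \<Longrightarrow> x i \<noteq> x j + p + q"
    and sidon: "\<And>i j k l p q. \<lbrakk>i \<in> I; j \<in> I; k \<in> I; l \<in> I; distinct [i, j, k, l]; p \<in> P; q \<in> P\<rbrakk> \<Longrightarrow>
      x i + p - x j \<noteq> x k + q - x l"
    and b_zero: "b 0 = 1" and b_supp: "\<And>t. b t \<noteq> 0 \<Longrightarrow> t \<in> V"
    and b_abs: "\<And>t. b t = complex_of_real (cmod (b t))" and b_le: "\<And>t. cmod (b t) \<le> 1"
    and b_luc: "left_uniformly_continuous (apply_bcontfun b)"
begin

lemma P_zero: "0 \<in> P"
  using V_sum[of 0 0 0 0] V_zero by simp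

text \<open>
  A coincidence of two differences forces two of the four indices to agree by the Sidon property.
  If these are the first or the second ones of both sides, cancellation and separation identify the
  other pair as well.  The crossed cases remain possible: if all elements of the group have order two,
  then \<open>x i - x j = x j - x i\<close>.
\<close>

lemma overlap_cases:
  assumes I: "i \<in> I" "j \<in> I" "k \<in> I" "l \<in> I" and ne: "i \<noteq> j" "k \<noteq> l"
    and p: "p \<in> P" and q: "q \<in> P" and eq: "x i + p - x j = x k + q - x l"
  shows "(i = k \<and> j = l) \<or> i = l \<or> j = k"
proof (rule ccontr)
  assume contra: "\<not> ((i = k \<and> j = l) \<or> i = l \<or> j = k)"
  have "i = k \<or> j = l"
  proof (rule ccontr)
    assume "\<not> (i = k \<or> j = l)"
    then have "distinct [i, j, k, l]"
      using ne contra by auto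
    then show False
      using sidon[OF I _ p q] eq by blast
  qed
  moreover have False if "i = k" "j \<noteq> l"
  proof -
    have "p - x j = q - x l"
      using eq \<open>i = k\<close> by (simp add: diff_conv_add_uminus add.assoc del: add_uminus_conv_diff)
    then have "- (p - x j) = - (q - x l)"
      by (rule arg_cong)
    then have "x j - p = x l - q"
      by (simp only: minus_diff_eq)
    then have "x j = x l + - q + p"
      by (simp add: diff_eq_eq)
    then show False
      using separated[OF I(2,4) that(2) P_minus[OF q] p] by blast
  qed
  moreover have False if "j = l" "i \<noteq> k"
  proof -
    have "x i + p = (x i + p - x j) + x j"
      by simp
    also have "\<dots> = x k + q"
      by (subst eq) (simp add: \<open>j = l\<close>)
    finally have "x i = x k + q + - p"
      by (simp add: eq_diff_eq)
    then show False
      using separated[OF I(1,3) that(2) q P_minus[OF p]] by blast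
  qed
  ultimately show False
    using contra by blast
qed

text \<open>
  Two copies of \<open>V\<close> rather than one: being near is stable under a further shift by an element of
  \<open>V\<close>.
\<close>

definition near :: "'k \<Rightarrow> 'a \<Rightarrow> bool" where
  "near i s \<longleftrightarrow> (\<exists>u\<in>V. \<exists>v\<in>V. s = x i + (u + v))"

lemma near_I: "- x i + s \<in> V \<Longrightarrow> near i s"
  unfolding near_def using V_zero by (intro bexI[of _ "- x i + s"] bexI[of _ 0]) (auto simp: add.assoc[symmetric])

text \<open>
  If the translates by \<open>s\<close> and \<open>s'\<close> of two bumps meet, then \<open>s - s'\<close> is a difference of the
  two points up to \<open>P\<close>.  All information on overlapping translates enters through this fact.
\<close>

lemma near_difference:
  assumes "near i (s + t)" "near j (s' + t)"
  shows "\<exists>p\<in>P. s - s' = x i + p - x j"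
proof -
  obtain u v u' v' where *: "s + t = x i + (u + v)" "s' + t = x j + (u' + v')"
    and V: "u \<in> V" "v \<in> V" "u' \<in> V" "v' \<in> V"
    using assms unfolding near_def by blast
  have "u + v + - v' + - u' \<in> P"
    using V V_minus by (intro V_sum) auto
  moreover have "u + v + - v' + - u' = (u + v) - (u' + v')"
    by (simp add: diff_conv_add_uminus minus_add add.assoc del: add_uminus_conv_diff)
  ultimately show ?thesis
    using group_shift_difference[OF *] by metis
qed

lemma near_unique:
  assumes "near i s" "near j s" "i \<in> I" "j \<in> I"
  shows "i = j"
proof (rule ccontr)
  assume "i \<noteq> j"
  obtain p where p: "p \<in> P" "s - s = x i + p - x j"
    using near_difference[of i s 0 j s] assms by auto
  then have "x j = x i + p"
    by simp
  then show False
    using separated[of j i p 0] \<open>i \<noteq> j\<close> assms P_zero p by simp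
qed

lemma near_same:
  assumes "near i (s + t)" "near i (s' + t)" "i \<in> I"
  shows "s - s' \<in> W"
  using near_difference[OF assms(1,2)] conj_W[OF assms(3)] by auto

text \<open>
  The sum has at most one term (\<open>near_unique\<close>).  It runs over the larger sets where \<open>t\<close> is near
  \<open>x i\<close>, so that the same index can be used at \<open>t\<close> and at points close to \<open>t\<close>.
\<close>

definition bump_sum_at :: "('k \<Rightarrow> complex) \<Rightarrow> 'a \<Rightarrow> complex" where
  "bump_sum_at c t = (\<Sum>i | i \<in> I \<and> near i t. c i * b (- x i + t))"

lemma bump_sum_at_near:
  assumes "i \<in> I" "near i t"
  shows "bump_sum_at c t = c i * b (- x i + t)"
proof -
  have "{i. i \<in> I \<and> near i t} = {i}"
    using assms near_unique by blast
  then show ?thesis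
    by (simp add: bump_sum_at_def)
qed

lemma bump_sum_at_nonzero:
  assumes "bump_sum_at c t \<noteq> 0"
  obtains i where "i \<in> I" "- x i + t \<in> V" "near i t" "bump_sum_at c t = c i * b (- x i + t)"
proof -
  have "\<exists>i\<in>I. near i t"
    using assms unfolding bump_sum_at_def by (metis (mono_tags, lifting) mem_Collect_eq sum.neutral)
  then obtain i where i: "i \<in> I" "near i t" by blast
  have "- x i + t \<in> V"
    using assms bump_sum_at_near[OF i] b_supp by auto
  with i show thesis
    using that bump_sum_at_near by blast
qed

lemma cmod_bump_sum_at_le:
  assumes "\<And>i. cmod (c i) \<le> C"
  shows "cmod (bump_sum_at c t) \<le> C"
proof (cases "bump_sum_at c t = 0")
  case True
  then show ?thesis using order_trans[OF norm_ge_zero assms] by simp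
next
  case False
  then obtain i where "bump_sum_at c t = c i * b (- x i + t)"
    by (rule bump_sum_at_nonzero)
  then show ?thesis
    using mult_mono[OF assms[of i] b_le[of "- x i + t"]] order_trans[OF norm_ge_zero assms[of i]]
    by (simp add: norm_mult)
qed

text \<open>
  Shifting \<open>t\<close> by \<open>u\<close> shifts the argument \<open>- x i + t\<close> of the bump by the conjugate
  \<open>- x i + u + x i\<close>, which is small uniformly in \<open>i\<close>.
\<close>

lemma bump_sum_at_luc:
  assumes c: "\<And>i. cmod (c i) \<le> C"
  shows "left_uniformly_continuous (bump_sum_at c)"
  unfolding left_uniformly_continuous_def
proof (intro allI impI)
  fix \<epsilon> :: real assume "\<epsilon> > 0"
  have C: "0 \<le> C" using order_trans[OF norm_ge_zero c] .
  then have "\<epsilon> / (C + 1) > 0" using \<open>\<epsilon> > 0\<close> by simp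
  then obtain U where U: "open U" "0 \<in> U" "\<And>u t. u \<in> U \<Longrightarrow> dist (b (u + t)) (b t) < \<epsilon> / (C + 1)"
    using b_luc unfolding left_uniformly_continuous_def by meson
  obtain U' where U': "open U'" "0 \<in> U'" "\<And>u i. u \<in> U' \<Longrightarrow> i \<in> I \<Longrightarrow> - x i + u + x i \<in> U \<inter> V"
    using conj_nbhd[of "U \<inter> V"] U V_open V_zero by blast
  have "dist (bump_sum_at c (u + t)) (bump_sum_at c t) < \<epsilon>" if u: "u \<in> U'" for u t
  proof -
    have bound: ?thesis if i: "i \<in> I" "near i (u + t)" "near i t" for i
    proof -
      define w where "w = - x i + u + x i"
      have w: "w + (- x i + t) = - x i + (u + t)"
        by (simp add: w_def add.assoc)
      have "dist (bump_sum_at c (u + t)) (bump_sum_at c t)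
          = cmod (c i) * dist (b (w + (- x i + t))) (b (- x i + t))"
        unfolding bump_sum_at_near[OF i(1,2)] bump_sum_at_near[OF i(1,3)] w
        by (simp add: dist_norm norm_mult flip: right_diff_distrib)
      also have "\<dots> \<le> C * (\<epsilon> / (C + 1))"
        using U'(3)[OF u i(1)] U(3)[of w "- x i + t"] unfolding w_def[symmetric]
        by (intro mult_mono c C) (auto simp: less_imp_le)
      also have "\<dots> < \<epsilon>"
        using C \<open>\<epsilon> > 0\<close> by (simp add: field_simps)
      finally show ?thesis .
    qed
    show ?thesis
    proof (cases "bump_sum_at c t = 0 \<and> bump_sum_at c (u + t) = 0")
      case True
      then show ?thesis using \<open>\<epsilon> > 0\<close> by simp
    next
      case False
      then obtain i where i: "i \<in> I" "- x i + t \<in> V \<or> - x i + (u + t) \<in> V"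
        by (metis bump_sum_at_nonzero)
      define w where "w = - x i + u + x i"
      have w: "w \<in> V"
        using U'(3)[OF u i(1)] by (simp add: w_def)
      have "near i t \<and> near i (u + t)"
        using i(2)
      proof
        assume v: "- x i + t \<in> V"
        have "u + t = x i + (w + (- x i + t))"
          by (simp add: w_def add.assoc)
        then show ?thesis
          using v w near_I unfolding near_def by blast
      next
        assume v: "- x i + (u + t) \<in> V"
        have "t = x i + (- w + (- x i + (u + t)))"
          by (simp add: w_def add.assoc minus_add diff_conv_add_uminus del: add_uminus_conv_diff)
        then show ?thesis
          using v V_minus[OF w] near_I unfolding near_def by blast
      qed
      then show ?thesis using bound i(1) by blast
    qed
  qed
  then show "\<exists>U. open U \<and> 0 \<in> U \<and> (\<forall>u\<in>U. \<forall>t. dist (bump_sum_at c (u + t)) (bump_sum_at c t) < \<epsilon>)"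
    using U' by blast
qed

definition bump_sum :: "('k \<Rightarrow> complex) \<Rightarrow> 'a \<Rightarrow>\<^sub>C complex" where
  "bump_sum c = Bcontfun (bump_sum_at c)"

lemma apply_bump_sum:
  assumes "\<And>i. cmod (c i) \<le> C"
  shows "apply_bcontfun (bump_sum c) = bump_sum_at c"
  unfolding bump_sum_def
proof (rule Bcontfun_inverse)
  show "bump_sum_at c \<in> bcontfun"
    unfolding bcontfun_def bounded_iff mem_Collect_eq
    by (intro conjI exI[of _ C] ballI left_uniformly_continuous_imp_continuous bump_sum_at_luc[OF assms])
       (auto intro: cmod_bump_sum_at_le assms)
qed

text \<open>
  By \<open>overlap_cases\<close> a second representation of \<open>r\<close> shares an index, in crossed position, with
  the first, and there is only one representation with a given first or second index.
\<close>

lemma finite_overlaps: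
  "finite {(i, j). i \<in> I \<and> j \<in> I \<and> i \<noteq> j \<and> (\<exists>p\<in>P. r = x i + p - x j)}" (is "finite ?O")
proof (cases "?O = {}")
  case False
  then obtain i j where ij: "(i, j) \<in> ?O" by auto
  have subsingleton: "finite A" if "\<And>a a'. a \<in> A \<Longrightarrow> a' \<in> A \<Longrightarrow> a = a'" for A :: "('k \<times> 'k) set"
  proof (cases "A = {}")
    case False
    then obtain a where "a \<in> A" by blast
    then have "A \<subseteq> {a}" using that by blast
    then show ?thesis by (rule finite_subset) simp
  qed simp
  have two: "(k = k' \<and> l = l') \<or> k = l' \<or> l = k'" if "(k, l) \<in> ?O" "(k', l') \<in> ?O" for k l k' l'
    using that overlap_cases[of k l k' l'] by auto
  have "finite (?O \<inter> UNIV \<times> {i})" "finite (?O \<inter> {j} \<times> UNIV)"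
    by (rule subsingleton, use two in blast)+
  moreover have "?O \<subseteq> {(i, j)} \<union> (?O \<inter> UNIV \<times> {i}) \<union> (?O \<inter> {j} \<times> UNIV)"
    using two[OF ij] by auto
  ultimately show ?thesis
    by (meson finite.emptyI finite.insertI finite_Un finite_subset)
next
  case True
  then show ?thesis by (simp only: finite.emptyI)
qed

end

section \<open>Decomposition of the translates of a bump sum\<close>

lemma card_le_3I:
  assumes "finite J"
    and "\<And>i j k l. {i, j, k, l} \<subseteq> J \<Longrightarrow> distinct [i, j, k, l] \<Longrightarrow> False"
  shows "card J \<le> 3"
proof (rule ccontr)
  assume "\<not> card J \<le> 3"
  then have "4 \<le> card J" by simp
  then obtain T where T: "T \<subseteq> J" "card T = 4"
    by (meson obtain_subset_with_card_n)
  obtain i j k l where "T = {i, j, k, l}" "distinct [i, j, k, l]"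
    using T(2) by (auto simp: card_Suc_eq numeral_eq_Suc)
  with T(1) assms(2)[of i j k l] show False by simp
qed

context sidon_bumps
begin

text \<open>
  All translates have a bump near \<open>y\<close>, the one with index \<open>\<alpha> n\<close>, which is subtracted.  If the remaining
  parts with numbers \<open>m\<close> and \<open>n\<close> are both nonzero at \<open>t\<close>, through indices \<open>\<beta> m\<close> and \<open>\<beta> n\<close>, then
  \<open>s m - s n\<close> has two representations, and \<open>overlap_cases\<close> leaves only \<open>\<alpha> m = \<beta> n\<close> or \<open>\<alpha> n = \<beta> m\<close>.
  As the \<open>\<alpha> n\<close> are distinct, every number \<open>n\<close> accounts for at most one of these equalities
  \<open>\<beta> n = \<alpha> m\<close>, whereas four numbers would require six.
\<close>

lemma separated_translates_decompose:
  assumes c: "\<And>i. cmod (c i) \<le> C"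
    and s: "\<And>m n. m < n \<Longrightarrow> s n - s m \<notin> W"
    and \<alpha>: "\<And>n. \<alpha> n \<in> I" "\<And>n. near (\<alpha> n) (s n + y)"
  shows "bounded_overlap (\<lambda>n t. bump_sum_at c (s n + t) - c (\<alpha> n) * b (- x (\<alpha> n) + (s n + t)))"
    (is "bounded_overlap ?g")
proof (rule bounded_overlapI)
  have inj: "\<alpha> m \<noteq> \<alpha> n" if "m \<noteq> n" for m n
    using that near_same[of "\<alpha> m" "s n" y "s m"] near_same[of "\<alpha> m" "s m" y "s n"] \<alpha> s
    by (metis linorder_neqE_nat)
  have g: "\<exists>\<beta>\<in>I. near \<beta> (s n + t) \<and> \<beta> \<noteq> \<alpha> n \<and> ?g n t = bump_sum_at c (s n + t)" if nz: "?g n t \<noteq> 0" for n t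
  proof -
    have not_near: "\<not> near (\<alpha> n) (s n + t)"
      using nz bump_sum_at_near[OF \<alpha>(1)] by auto
    then have "b (- x (\<alpha> n) + (s n + t)) = 0"
      using b_supp near_I by blast
    then have "?g n t = bump_sum_at c (s n + t)"
      by simp
    with nz not_near show ?thesis
      by (metis bump_sum_at_nonzero)
  qed
  show "cmod (?g n t) \<le> C" for n t
  proof (cases "?g n t = 0")
    case True
    then show ?thesis using order_trans[OF norm_ge_zero c] by simp
  next
    case False
    from g[OF this] cmod_bump_sum_at_le[of c C, OF c] show ?thesis by auto
  qed
  fix t and J :: "nat set"
  assume J: "finite J" "\<forall>n\<in>J. ?g n t \<noteq> 0"
  have "\<forall>n\<in>J. \<exists>\<beta>. \<beta> \<in> I \<and> near \<beta> (s n + t) \<and> \<beta> \<noteq> \<alpha> n"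
    using J(2) g by blast
  from bchoice[OF this] obtain \<beta> where \<beta>: "\<And>n. n \<in> J \<Longrightarrow> \<beta> n \<in> I"
      "\<And>n. n \<in> J \<Longrightarrow> near (\<beta> n) (s n + t)" "\<And>n. n \<in> J \<Longrightarrow> \<beta> n \<noteq> \<alpha> n"
    by blast
  have swap: "\<alpha> m = \<beta> n \<or> \<alpha> n = \<beta> m" if mn: "m \<in> J" "n \<in> J" "m \<noteq> n" for m n
  proof -
    have "\<beta> m \<noteq> \<beta> n"
      using mn near_same[of "\<beta> m" "s n" t "s m"] near_same[of "\<beta> m" "s m" t "s n"] \<beta> s
      by (metis linorder_neqE_nat)
    moreover obtain p where "p \<in> P" "s m - s n = x (\<alpha> m) + p - x (\<alpha> n)"
      using near_difference[OF \<alpha>(2) \<alpha>(2)] by blast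
    moreover obtain q where "q \<in> P" "s m - s n = x (\<beta> m) + q - x (\<beta> n)"
      using near_difference[OF \<beta>(2)[OF mn(1)] \<beta>(2)[OF mn(2)]] by blast
    ultimately show ?thesis
      using overlap_cases[of "\<alpha> m" "\<alpha> n" "\<beta> m" "\<beta> n" p q] \<alpha>(1) \<beta> mn inj[OF mn(3)] by metis
  qed
  show "card J \<le> 3"
  proof (rule card_le_3I[OF J(1)])
    fix i j k l assume "{i, j, k, l} \<subseteq> J" and d: "distinct [i, j, k, l]"
    then have "i \<in> J" "j \<in> J" "k \<in> J" "l \<in> J" by auto
    moreover have "\<alpha> i \<noteq> \<alpha> j" "\<alpha> i \<noteq> \<alpha> k" "\<alpha> i \<noteq> \<alpha> l" "\<alpha> j \<noteq> \<alpha> k" "\<alpha> j \<noteq> \<alpha> l" "\<alpha> k \<noteq> \<alpha> l"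
      using d inj by auto
    ultimately show False
      using swap[of i j] swap[of i k] swap[of i l] swap[of j k] swap[of j l] swap[of k l] d
      by (simp; metis)
  qed
qed

text \<open>
  There are two cases.  If some point \<open>y\<close> is close to a bump in all translates from a set of
  parameters that is not relatively compact, these bumps are the main terms and the previous lemma
  applies.  Otherwise no bump has to be subtracted: the parameters can be chosen so that no point where
  two earlier translates meet is hit by a later one, which leaves at most two nonzero values at
  each point.
\<close>

lemma translates_decompose:
  assumes c: "\<And>i. cmod (c i) \<le> C" and S: "\<nexists>K. compact K \<and> S \<subseteq> K"
  shows "\<exists>s d y K. compact K \<and> (\<forall>n::nat. s n \<in> S \<and> cmod (d n) \<le> C \<and> y n \<in> K) \<and>
    bounded_overlap (\<lambda>n t. bump_sum_at c (s n + t) - d n * b (- y n + t))"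
proof (cases "\<exists>y. \<nexists>K. compact K \<and> {s\<in>S. \<exists>i\<in>I. near i (s + y)} \<subseteq> K")
  case True
  then obtain y where y: "\<nexists>K. compact K \<and> {s\<in>S. \<exists>i\<in>I. near i (s + y)} \<subseteq> K" by blast
  define B where "B F = (\<Union>a\<in>F. (\<lambda>w. w + a) ` W)" for F
  have "compact (B F)" if "finite F" for F
    unfolding B_def using that by (intro compact_UN compact_right_translate W_compact)
  from sequence_avoiding_compacts[OF y this]
  obtain s :: "nat \<Rightarrow> 'a"
    where "\<forall>n. s n \<in> {s\<in>S. \<exists>i\<in>I. near i (s + y)} \<and> s n \<notin> B (s ` {..<n})"
    by (rule exE)
  then have s: "s n \<in> S" "\<exists>i\<in>I. near i (s n + y)" "s n \<notin> B (s ` {..<n})" for n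
    by simp_all
  obtain \<alpha> where \<alpha>: "\<And>n. \<alpha> n \<in> I" "\<And>n. near (\<alpha> n) (s n + y)"
    using s(2) by metis
  have sep: "s n - s m \<notin> W" if "m < n" for m n
  proof
    assume "s n - s m \<in> W"
    then have "s n \<in> (\<lambda>w. w + s m) ` W"
      by (intro image_eqI[of _ _ "s n - s m"]) simp_all
    then have "s n \<in> B (s ` {..<n})"
      unfolding B_def using that by auto
    then show False
      using s by blast
  qed
  \<comment> \<open>The location of the main bump differs from \<open>y\<close> by an element of \<open>P\<close>.\<close>
  have yK: "- s n + x (\<alpha> n) \<in> (\<lambda>w. y + w) ` P" for n
  proof -
    obtain u v where uv: "u \<in> V" "v \<in> V" "s n + y = x (\<alpha> n) + (u + v)"
      using \<alpha>(2)[of n] unfolding near_def by blast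
    have "u + v + 0 + 0 \<in> P"
      by (intro V_sum uv V_zero)
    then have "- (u + v) \<in> P"
      by (intro P_minus) simp
    moreover have "- s n + x (\<alpha> n) = y + - (u + v)"
    proof -
      have "x (\<alpha> n) = s n + y + - (u + v)"
        using uv(3) by (simp add: add.assoc del: add_uminus_conv_diff)
      then show ?thesis
        by (simp add: add.assoc[symmetric] del: add_uminus_conv_diff)
    qed
    ultimately show ?thesis by blast
  qed
  have eq: "- (- s n + x (\<alpha> n)) + t = - x (\<alpha> n) + (s n + t)" for n t
    by (simp add: minus_add add.assoc)
  show ?thesis
    using separated_translates_decompose[of c C s \<alpha> y, OF c sep \<alpha>] s(1) c yK compact_left_translate[OF P_compact]
    by (intro exI[of _ s] exI[of _ "\<lambda>n. c (\<alpha> n)"] exI[of _ "\<lambda>n. - s n + x (\<alpha> n)"] exI[of _ "(\<lambda>w. y + w) ` P"])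
       (simp only: eq simp_thms)
next
  case False
  then obtain K where K: "\<And>y. compact (K y)" "\<And>y. {s\<in>S. \<exists>i\<in>I. near i (s + y)} \<subseteq> K y"
    by metis
  \<comment> \<open>\<open>Y r r'\<close> contains the locations where the translates by \<open>r\<close> and \<open>r'\<close> may meet, and \<open>K y\<close>
    the parameters of translates with a bump close to \<open>y\<close>.\<close>
  define Y where "Y r r' = (\<lambda>(i, j). - r + x i) `
    {(i, j). i \<in> I \<and> j \<in> I \<and> i \<noteq> j \<and> (\<exists>p\<in>P. r - r' = x i + p - x j)}" for r r'
  have finY: "finite (Y r r')" for r r'
    unfolding Y_def by (intro finite_imageI finite_overlaps)
  define B where "B F = (\<Union>a\<in>F. (\<lambda>w. w + a) ` W) \<union> (\<Union>r\<in>F. \<Union>r'\<in>F. \<Union>y\<in>Y r r'. K y)" for F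
  have "compact (B F)" if "finite F" for F
    unfolding B_def using that
    by (intro compact_Un compact_UN compact_right_translate W_compact finY K(1))
  from sequence_avoiding_compacts[OF S this]
  obtain s :: "nat \<Rightarrow> 'a" where "\<forall>n. s n \<in> S \<and> s n \<notin> B (s ` {..<n})"
    by (rule exE)
  then have s: "s n \<in> S" "s n \<notin> B (s ` {..<n})" for n
    by simp_all
  have sep: "s n - s m \<notin> W" if "m < n" for m n
  proof
    assume "s n - s m \<in> W"
    then have "s n \<in> (\<lambda>w. w + s m) ` W"
      by (intro image_eqI[of _ _ "s n - s m"]) simp_all
    then have "s n \<in> B (s ` {..<n})"
      unfolding B_def using that by auto
    then show False
      using s by blast
  qed
  have "bounded_overlap (\<lambda>n t. bump_sum_at c (s n + t))"
  proof (rule bounded_overlapI)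
    show "cmod (bump_sum_at c (s n + t)) \<le> C" for n t
      by (rule cmod_bump_sum_at_le[OF c])
    fix t and J :: "nat set"
    assume J: "finite J" "\<forall>n\<in>J. bump_sum_at c (s n + t) \<noteq> 0"
    have act: "\<exists>i\<in>I. - x i + (s n + t) \<in> V \<and> near i (s n + t)" if "n \<in> J" for n
      using J(2) that by (metis bump_sum_at_nonzero)
    \<comment> \<open>The parameter with the largest number avoids all points where two earlier translates meet.\<close>
    have "card (J - {Max J}) \<le> Suc 0"
      unfolding card_le_Suc0_iff_eq[OF finite_Diff[OF J(1)]]
    proof (intro ballI)
      fix m n assume m: "m \<in> J - {Max J}" and n: "n \<in> J - {Max J}"
      define k where "k = Max J"
      have "J \<noteq> {}"
        using m by blast
      then have k: "k \<in> J" "m < k" "n < k"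
        using m n Max_in[OF J(1)] Max_ge[OF J(1), of m] Max_ge[OF J(1), of n] unfolding k_def
        by (simp_all add: less_le)
      obtain i where i: "i \<in> I" "- x i + (s m + t) \<in> V" "near i (s m + t)"
        using act m by blast
      obtain j where j: "j \<in> I" "near j (s n + t)"
        using act n by blast
      obtain l where l: "l \<in> I" "- x l + (s k + t) \<in> V"
        using act k by blast
      show "m = n"
      proof (rule ccontr)
        assume "m \<noteq> n"
        then have "i \<noteq> j"
          using near_same[of i "s n" t "s m"] near_same[of i "s m" t "s n"] i j sep
          by (metis linorder_neqE_nat)
        moreover obtain p where "p \<in> P" "s m - s n = x i + p - x j"
          using near_difference[OF i(3) j(2)] by blast
        ultimately have yY: "- s m + x i \<in> Y (s m) (s n)"
          unfolding Y_def using i j by force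
        have "s k + (- s m + x i) = x l + ((- x l + (s k + t)) + - (- x i + (s m + t)))"
          by (simp add: add.assoc minus_add diff_conv_add_uminus del: add_uminus_conv_diff)
        then have "near l (s k + (- s m + x i))"
          unfolding near_def using l(2) V_minus[OF i(2)] by blast
        then have "s k \<in> K (- s m + x i)"
          using K(2) s(1) l(1) by blast
        then have "s k \<in> B (s ` {..<k})"
          unfolding B_def using yY k(2,3) by blast
        with s(2) show False by blast
      qed
    qed
    then show "card J \<le> 2"
      using J(1) by (simp add: card_Diff_singleton_if split: if_splits)
  qed
  moreover have "0 \<le> C" using order_trans[OF norm_ge_zero c] .
  ultimately show ?thesis
    using s(1) by (intro exI[of _ s] exI[of _ "\<lambda>_. 0"] exI[of _ "\<lambda>_. 0"] exI[of _ "{0}"]) simp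
qed

end

section \<open>Bump sums are weakly almost periodic with mean zero\<close>

context sidon_bumps
begin

abbreviation bump :: "complex \<times> 'a \<Rightarrow> 'a \<Rightarrow>\<^sub>C complex" where
  "bump p \<equiv> cscale (fst p) (left_translate (- snd p) b)"

lemma continuous_on_bump: "continuous_on D bump"
proof -
  have "continuous_on D (\<lambda>p. left_translate (- snd p) b)"
    by (rule continuous_on_compose2[OF continuous_on_left_translate[OF b_luc]])
       (auto intro!: continuous_intros)
  then show ?thesis
    by (intro bounded_bilinear.continuous_on[OF bounded_bilinear_cscale] continuous_intros)
qed

text \<open>
  The supports are pairwise disjoint.
\<close>

lemma translated_bumps_bounded_overlap:
  assumes y: "\<And>m n. m < n \<Longrightarrow> y n \<notin> (\<lambda>w. y m + w) ` P" and d: "\<And>n. cmod (d n) \<le> C"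
  shows "bounded_overlap (\<lambda>n. apply_bcontfun (bump (d n, y n)))"
proof (rule bounded_overlapI)
  show "cmod (bump (d n, y n) t) \<le> C" for n t
    using mult_mono[OF d[of n] b_le[of "- y n + t"]] order_trans[OF norm_ge_zero d[of n]]
    by (simp add: norm_mult)
  fix t and J :: "nat set"
  assume J: "finite J" "\<forall>n\<in>J. bump (d n, y n) t \<noteq> 0"
  have V: "- y n + t \<in> V" if "n \<in> J" for n
    using J(2) that b_supp by auto
  have False if "m \<in> J" "n \<in> J" "m < n" for m n
  proof -
    have "(- y m + t) + - (- y n + t) + 0 + 0 \<in> P"
      by (intro V_sum V V_minus V_zero that)
    moreover have "y n = y m + ((- y m + t) + - (- y n + t) + 0 + 0)"
      by (simp add: add.assoc minus_add diff_conv_add_uminus del: add_uminus_conv_diff)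
    ultimately show False
      using y[OF that(3)] by blast
  qed
  then have "\<forall>m\<in>J. \<forall>n\<in>J. m = n"
    by (metis linorder_neqE_nat)
  then show "card J \<le> Suc 0"
    using card_le_Suc0_iff_eq[OF J(1)] by blast
qed

lemma separated_sequence:
  fixes S :: "'a set"
  assumes "\<nexists>K. compact K \<and> S \<subseteq> K"
  shows "\<exists>y :: nat \<Rightarrow> 'a. (\<forall>n. y n \<in> S) \<and> (\<forall>m n. m < n \<longrightarrow> y n \<notin> (\<lambda>w. y m + w) ` P)"
proof -
  define B where "B F = (\<Union>a\<in>F. (\<lambda>w. a + w) ` P)" for F :: "'a set"
  have "compact (B F)" if "finite F" for F
    unfolding B_def using that by (intro compact_UN compact_left_translate P_compact)
  from sequence_avoiding_compacts[OF assms this]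
  obtain y :: "nat \<Rightarrow> 'a" where y: "\<forall>n. y n \<in> S \<and> y n \<notin> B (y ` {..<n})"
    by (rule exE)
  have "y n \<notin> (\<lambda>w. y m + w) ` P" if "m < n" for m n
  proof
    assume "y n \<in> (\<lambda>w. y m + w) ` P"
    then have "y n \<in> B (y ` {..<n})"
      unfolding B_def using that by auto
    with y show False by simp
  qed
  with y show ?thesis
    by (intro exI[of _ y]) simp
qed

text \<open>
  Besides the translates themselves, the weak closure of the orbit of a bump sum with coefficients
  bounded by \<open>C\<close> contains only elements of this set.
\<close>

definition bumps :: "real \<Rightarrow> ('a \<Rightarrow>\<^sub>C complex) set" where
  "bumps C = bump ` (cball 0 C \<times> UNIV) \<union> {0}"

text \<open>
  The coefficients range over a compact disc, so only the locations can escape to infinity, and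
  bumps that escape have disjoint supports and tend weakly to \<open>0\<close>.
\<close>

lemma compactin_weak_bumps: "compactin weak_topology (bumps C)"
  unfolding bumps_def
proof (rule compactin_weak_criterion)
  show "continuous_on (cball 0 C \<times> UNIV) bump"
    by (rule continuous_on_bump)
  show "compactin weak_topology {0 :: 'a \<Rightarrow>\<^sub>C complex}"
    by (intro finite_imp_compactin) auto
  fix S :: "(complex \<times> 'a) set"
  assume S: "S \<subseteq> cball 0 C \<times> UNIV" and nc: "\<nexists>K. compact K \<and> S \<subseteq> K \<and> K \<subseteq> cball 0 C \<times> UNIV"
  have "\<nexists>K. compact K \<and> snd ` S \<subseteq> K"
  proof
    assume "\<exists>K. compact K \<and> snd ` S \<subseteq> K"
    then obtain K where K: "compact K" "snd ` S \<subseteq> K" by (elim exE conjE)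
    have "compact (cball (0::complex) C \<times> K)"
      by (intro compact_Times compact_cball K)
    moreover have "S \<subseteq> cball 0 C \<times> K"
      using S K(2) by force
    ultimately show False
      using nc by blast
  qed
  from separated_sequence[OF this] obtain y :: "nat \<Rightarrow> 'a"
    where y: "\<forall>n. y n \<in> snd ` S" "\<forall>m n. m < n \<longrightarrow> y n \<notin> (\<lambda>w. y m + w) ` P"
    by (elim exE conjE)
  have "\<forall>n. \<exists>d. (d, y n) \<in> S"
    using y(1) by force
  from choice[OF this] obtain d where d: "\<forall>n. (d n, y n) \<in> S"
    by (rule exE)
  then have "\<forall>n. cmod (d n) \<le> C"
    using S by force
  then have "bounded_overlap (\<lambda>n. apply_bcontfun (bump (d n, y n)))"
    by (intro translated_bumps_bounded_overlap[where C = C]) (use y(2) in simp_all)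
  then show "\<exists>h g N. compact N \<and> N \<subseteq> {0} \<and> (\<forall>j::nat. h j \<in> N) \<and>
      bounded_overlap (\<lambda>j. apply_bcontfun (g j)) \<and> (\<forall>j. h j + g j \<in> bump ` S)"
    using d by (intro exI[of _ "\<lambda>_. 0"] exI[of _ "\<lambda>n. bump (d n, y n)"] exI[of _ "{0}"])
      (simp del: fst_conv snd_conv)
qed

lemma bump_in_WAP: "bump p \<in> WAP"
proof (rule WAP_if_orbit_in_weakly_compact[OF compactin_weak_bumps[of "cmod (fst p)"]])
  have "left_translate s (bump p) = bump (fst p, - s + snd p)" for s
    by (rule bcontfun_eqI) (simp add: add.assoc minus_add)
  then show "range (\<lambda>s. left_translate s (bump p)) \<subseteq> bumps (cmod (fst p))"
    unfolding bumps_def by (auto simp del: fst_conv snd_conv intro!: imageI)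
qed

text \<open>
  The translates fulfil the criterion with the multiples of bumps as limit set, by
  \<open>translates_decompose\<close>.
\<close>

lemma bump_sum_in_WAP:
  assumes c: "\<And>i. cmod (c i) \<le> C"
  shows "bump_sum c \<in> WAP"
proof (rule WAP_if_orbit_in_weakly_compact)
  note app = apply_bump_sum[of c C, OF c]
  show "compactin weak_topology (range (\<lambda>s. left_translate s (bump_sum c)) \<union> bumps C)"
  proof (rule compactin_weak_criterion[OF _ compactin_weak_bumps])
    show "continuous_on UNIV (\<lambda>s. left_translate s (bump_sum c))"
      using bump_sum_at_luc[of c C, OF c] by (intro continuous_on_left_translate) (simp add: app)
    fix S :: "'a set"
    assume "\<nexists>K. compact K \<and> S \<subseteq> K \<and> K \<subseteq> UNIV"
    then have nc: "\<nexists>K. compact K \<and> S \<subseteq> K" by simp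
    from translates_decompose[of c C, OF c nc] obtain s d y K where
      K: "compact K" "\<forall>n::nat. s n \<in> S \<and> cmod (d n) \<le> C \<and> y n \<in> K" and
      bo: "bounded_overlap (\<lambda>n t. bump_sum_at c (s n + t) - d n * b (- y n + t))"
      by (elim exE conjE)
    define N where "N = bump ` (cball 0 C \<times> K)"
    define h where "h n = bump (d n, y n)" for n
    define g where "g n = left_translate (s n) (bump_sum c) - h n" for n
    have "compact N"
      unfolding N_def by (intro compact_continuous_image continuous_on_bump compact_Times compact_cball K)
    moreover have "N \<subseteq> bumps C"
      unfolding N_def bumps_def by blast
    moreover have "\<forall>n. h n \<in> N"
      unfolding N_def h_def using K(2) by (intro allI imageI) simp
    moreover have "bounded_overlap (\<lambda>n. apply_bcontfun (g n))"
      using bo unfolding g_def h_def by (simp add: app minus_apply fun_diff_def)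
    moreover have "\<forall>n. h n + g n \<in> (\<lambda>s. left_translate s (bump_sum c)) ` S"
      unfolding g_def using K(2) by simp
    ultimately show "\<exists>h g N. compact N \<and> N \<subseteq> bumps C \<and> (\<forall>j::nat. h j \<in> N) \<and>
      bounded_overlap (\<lambda>j. apply_bcontfun (g j)) \<and> (\<forall>j. h j + g j \<in> (\<lambda>s. left_translate s (bump_sum c)) ` S)"
      by blast
  qed
qed simp

context
  fixes \<mu> :: "('a \<Rightarrow>\<^sub>C complex) \<Rightarrow> complex"
  assumes \<mu>: "invariant_mean_WAP \<mu>" and noncompact: "\<not> compact (UNIV :: 'a set)"
begin

lemma UNIV_not_in_compact: "\<nexists>K. compact K \<and> (UNIV :: 'a set) \<subseteq> K"
  using noncompact by (metis top.extremum_unique)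

text \<open>
  Translates of the bump to the points of a separated sequence have disjoint supports.
\<close>

lemma mean_bump: "\<mu> (bump p) = 0"
proof -
  obtain y :: "nat \<Rightarrow> 'a" where y: "\<forall>m n. m < n \<longrightarrow> y n \<notin> (\<lambda>w. y m + w) ` P"
    using separated_sequence[OF UNIV_not_in_compact] by (elim exE conjE)
  have "bounded_overlap (\<lambda>n. apply_bcontfun (bump (fst p, y n)))"
    by (rule translated_bumps_bounded_overlap[where C = "cmod (fst p)"]) (use y in simp_all)
  moreover have "bump p (snd p - y n + t) - apply_bcontfun 0 t = bump (fst p, y n) t" for n t
    by (simp add: add.assoc diff_conv_add_uminus del: add_uminus_conv_diff)
  ultimately have "bounded_overlap (\<lambda>n t. bump p (snd p - y n + t) - apply_bcontfun 0 t)"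
    by (simp only:)
  moreover have "\<mu> 0 = 0"
    using \<mu> zero_in_WAP unfolding invariant_mean_WAP_def by (metis add_0 add_cancel_right_left)
  ultimately show ?thesis
    by (intro mean_zero_if_bounded_overlap[OF \<mu> bump_in_WAP, where h = "\<lambda>_. 0" and s = "\<lambda>n. snd p - y n"])
       (simp_all add: zero_in_WAP)
qed

lemma mean_bump_sum:
  assumes c: "\<And>i. cmod (c i) \<le> C"
  shows "\<mu> (bump_sum c) = 0"
proof -
  obtain s d y where bo: "bounded_overlap (\<lambda>n::nat. \<lambda>t. bump_sum_at c (s n + t) - d n * b (- y n + t))"
    using translates_decompose[of c C, OF c UNIV_not_in_compact] by (elim exE conjE)
  have "- bump (d n, y n) = bump (- d n, y n)" for n
    by (rule bcontfun_eqI) simp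
  then have "- bump (d n, y n) \<in> WAP" for n
    by (simp only: bump_in_WAP)
  moreover have "bounded_overlap (\<lambda>n t. bump_sum c (s n + t) - bump (d n, y n) t)"
    using bo by (simp add: apply_bump_sum[of c C, OF c])
  ultimately show ?thesis
    by (intro mean_zero_if_bounded_overlap[OF \<mu> bump_sum_in_WAP[of c C, OF c], where h = "\<lambda>n. bump (d n, y n)"])
       (simp_all only: bump_in_WAP mean_bump)
qed

text \<open>
  The absolute value of a bump sum is the bump sum of the absolute values, because the bump is
  nonnegative and the supports are disjoint.
\<close>

lemma bump_sum_in_WAP0:
  assumes c: "\<And>i. cmod (c i) \<le> C"
  shows "bump_sum c \<in> WAP0 \<mu>"
proof -
  have c': "cmod (complex_of_real (cmod (c i))) \<le> C" for i
    using c by simp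
  have "cb_abs (bump_sum c) = bump_sum (\<lambda>i. complex_of_real (cmod (c i)))"
  proof (rule bcontfun_eqI)
    fix t
    show "cb_abs (bump_sum c) t = bump_sum (\<lambda>i. complex_of_real (cmod (c i))) t"
    proof (cases "\<exists>i\<in>I. near i t")
      case True
      then obtain i where i: "i \<in> I" "near i t" by blast
      have "complex_of_real (cmod (b (- x i + t))) = b (- x i + t)"
        using b_abs by simp
      then show ?thesis
        by (simp add: apply_bump_sum[of _ C, OF c] apply_bump_sum[of _ C, OF c'] bump_sum_at_near[OF i] norm_mult)
    next
      case False
      then have "bump_sum_at c' t = 0" for c'
        using bump_sum_at_nonzero by blast
      then show ?thesis
        by (simp add: apply_bump_sum[of _ C, OF c] apply_bump_sum[of _ C, OF c'])
    qed
  qed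
  then show ?thesis
    unfolding WAP0_def using bump_sum_in_WAP[of c C, OF c] mean_bump_sum[of _ C, OF c'] by simp
qed

end

end

section \<open>The quotient by the functions vanishing at infinity\<close>

text \<open>
  The projection of \<open>F \<times> F\<close> to a factor has infinite fibres, and \<open>F \<times> F\<close> is equipotent to \<open>F\<close>.
\<close>

lemma infinite_fibres_map:
  assumes "infinite F"
  obtains \<pi> :: "'k \<Rightarrow> 'k" where "\<And>i. i \<in> F \<Longrightarrow> infinite {j \<in> F. \<pi> j = i}"
proof -
  have "|F| =o |F \<times> F|"
    using card_of_Times_same_infinite[OF assms] by (rule ordIso_symmetric)
  then obtain h where h: "bij_betw h F (F \<times> F)"
    using card_of_ordIso by blast
  have "infinite {j \<in> F. fst (h j) = i}" if "i \<in> F" for i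
  proof
    assume "finite {j \<in> F. fst (h j) = i}"
    then have "finite (h ` {j \<in> F. fst (h j) = i})"
      by (rule finite_imageI)
    moreover have "{i} \<times> F \<subseteq> h ` {j \<in> F. fst (h j) = i}"
    proof
      fix p assume p: "p \<in> {i} \<times> F"
      then have "p \<in> h ` F"
        using h that unfolding bij_betw_def by auto
      then obtain j where "j \<in> F" "p = h j" by blast
      with p show "p \<in> h ` {j \<in> F. fst (h j) = i}"
        by (intro image_eqI[of _ _ j]) (auto simp: mem_Times_iff)
    qed
    ultimately have "finite ({i} \<times> F)"
      by (rule finite_subset[rotated])
    then have "finite (snd ` ({i} \<times> F))"
      by (rule finite_imageI)
    with assms show False by simp
  qed
  then show thesis
    using that[of "\<lambda>j. fst (h j)"] by simp
qed

lemma cmod_le_linf_norm: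
  assumes "\<xi> \<in> linf S"
  shows "cmod (\<xi> i) \<le> linf_norm S \<xi>"
proof -
  have bdd: "bdd_above (insert 0 ((\<lambda>i. cmod (\<xi> i)) ` S))"
    using assms bounded_norm_comp[of \<xi> S] bounded_imp_bdd_above unfolding linf_def by simp
  show ?thesis
  proof (cases "i \<in> S")
    case True
    then show ?thesis unfolding linf_norm_def by (intro cSup_upper bdd) simp
  next
    case False
    then have "cmod (\<xi> i) = 0" using assms by (simp add: linf_def)
    then show ?thesis unfolding linf_norm_def by (intro cSup_upper bdd) simp
  qed
qed

lemma linf_norm_le:
  assumes "\<And>i. i \<in> S \<Longrightarrow> cmod (\<xi> i) \<le> B" "0 \<le> B"
  shows "linf_norm S \<xi> \<le> B"
  unfolding linf_norm_def using assms by (intro cSup_least) auto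

lemma zero_in_C0: "0 \<in> C0"
  unfolding C0_def by (auto intro!: exI[of _ "{}"])

lemma C0_add:
  fixes f g :: "'a::t2_space \<Rightarrow>\<^sub>C complex"
  assumes "f \<in> C0" "g \<in> C0"
  shows "f + g \<in> C0"
  unfolding C0_def
proof (intro CollectI allI impI)
  fix \<epsilon> :: real assume "\<epsilon> > 0"
  then have "\<epsilon> / 2 > 0" by simp
  then obtain K L where K: "compact K" "\<forall>t. t \<notin> K \<longrightarrow> cmod (f t) < \<epsilon> / 2"
    and L: "compact L" "\<forall>t. t \<notin> L \<longrightarrow> cmod (g t) < \<epsilon> / 2"
    using assms unfolding C0_def by blast
  have "cmod ((f + g) t) < \<epsilon>" if "t \<notin> K \<union> L" for t
  proof -
    have "cmod (f t) < \<epsilon> / 2" "cmod (g t) < \<epsilon> / 2"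
      using that K(2) L(2) by simp_all
    then show ?thesis
      using norm_triangle_ineq[of "f t" "g t"] by simp
  qed
  then show "\<exists>K. compact K \<and> (\<forall>t. t \<notin> K \<longrightarrow> cmod ((f + g) t) < \<epsilon>)"
    using compact_Un[OF K(1) L(1)] by blast
qed

lemma C0_cscale:
  assumes "f \<in> C0"
  shows "cscale c f \<in> C0"
  unfolding C0_def
proof (intro CollectI allI impI)
  fix \<epsilon> :: real assume "\<epsilon> > 0"
  then have \<epsilon>: "\<epsilon> / (cmod c + 1) > 0"
    by (simp add: add_nonneg_pos)
  then obtain K where K: "compact K" "\<forall>t. t \<notin> K \<longrightarrow> cmod (f t) < \<epsilon> / (cmod c + 1)"
    using assms unfolding C0_def by blast
  have "cmod (cscale c f t) < \<epsilon>" if "t \<notin> K" for t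
  proof -
    have "cmod (f t) < \<epsilon> / (cmod c + 1)"
      using K(2) that by blast
    then have "cmod c * cmod (f t) \<le> cmod c * (\<epsilon> / (cmod c + 1))"
      by (intro mult_left_mono) simp_all
    also have "\<dots> < (cmod c + 1) * (\<epsilon> / (cmod c + 1))"
      by (rule mult_strict_right_mono[OF _ \<epsilon>]) simp
    also have "\<dots> = \<epsilon>"
      using norm_ge_zero[of c] by (simp add: add_nonneg_eq_0_iff)
    finally show ?thesis
      by (simp add: norm_mult)
  qed
  with K(1) show "\<exists>K. compact K \<and> (\<forall>t. t \<notin> K \<longrightarrow> cmod (cscale c f t) < \<epsilon>)"
    by blast
qed

lemma coset_C0_add:
  fixes f g :: "'a::t2_space \<Rightarrow>\<^sub>C complex"
  shows "(f +o C0) + (g +o C0) = (f + g) +o C0"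
proof -
  have "(C0 :: ('a \<Rightarrow>\<^sub>C complex) set) + C0 = C0"
  proof
    show "(C0 :: ('a \<Rightarrow>\<^sub>C complex) set) + C0 \<subseteq> C0"
      by (auto simp: set_plus_def intro: C0_add)
    show "(C0 :: ('a \<Rightarrow>\<^sub>C complex) set) \<subseteq> C0 + C0"
      using set_zero_plus2[OF zero_in_C0] .
  qed
  then show ?thesis
    by (simp add: set_plus_rearrange)
qed

lemma quotient_scale_coset_C0:
  fixes f :: "'a::t2_space \<Rightarrow>\<^sub>C complex"
  shows "quotient_scale C0 c (f +o C0) = cscale c f +o C0"
proof
  have add: "cscale c (u + v) = cscale c u + cscale c v" for u v :: "'a \<Rightarrow>\<^sub>C complex"
    using bounded_bilinear.add_right[OF bounded_bilinear_cscale] .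
  show "quotient_scale C0 c (f +o C0) \<subseteq> cscale c f +o C0"
  proof
    fix u assume "u \<in> quotient_scale C0 c (f +o C0)"
    then obtain h h' where "h \<in> C0" "h' \<in> C0" "u = cscale c (f + h) + h'"
      unfolding quotient_scale_def set_plus_def elt_set_plus_def by auto
    then have "u = cscale c f + (cscale c h + h')" "cscale c h + h' \<in> C0"
      by (simp_all add: add C0_add C0_cscale add.assoc)
    then show "u \<in> cscale c f +o C0"
      unfolding elt_set_plus_def by blast
  qed
  show "cscale c f +o C0 \<subseteq> quotient_scale C0 c (f +o C0)"
  proof
    fix u assume "u \<in> cscale c f +o C0"
    then obtain h where "h \<in> C0" "u = cscale c f + h"
      unfolding elt_set_plus_def by auto
    moreover have "f \<in> f +o C0"
      using zero_in_C0 unfolding elt_set_plus_def by force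
    ultimately show "u \<in> quotient_scale C0 c (f +o C0)"
      unfolding quotient_scale_def by (auto intro: set_plus_intro)
  qed
qed

context sidon_bumps
begin

lemma near_self: "near i (x i)"
  by (rule near_I) (simp add: V_zero)

text \<open>
  A translate of \<open>V\<close> contains at most one of the points, and finitely many translates cover \<open>K\<close>.
\<close>

lemma finite_in_compact:
  assumes "compact K"
  shows "finite {i \<in> I. x i \<in> K}"
proof -
  have "open ((\<lambda>s. - t + s) -` V)" for t
    using V_open by (intro open_vimage continuous_intros)
  moreover have "K \<subseteq> (\<Union>t\<in>K. (\<lambda>s. - t + s) -` V)"
    using V_zero by auto
  ultimately obtain C where C: "finite C" "K \<subseteq> (\<Union>t\<in>C. (\<lambda>s. - t + s) -` V)"
    using compactE_image[OF assms, of K "\<lambda>t. (\<lambda>s. - t + s) -` V"] by metis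
  have "finite {i \<in> I. - t + x i \<in> V}" for t
  proof (cases "{i \<in> I. - t + x i \<in> V} = {}")
    case False
    then obtain i where i: "i \<in> I" "- t + x i \<in> V" by blast
    have "j = i" if j: "j \<in> I" "- t + x j \<in> V" for j
    proof -
      have "x j = x i + (- (- t + x i) + (- t + x j))"
        by (simp add: add.assoc minus_add diff_conv_add_uminus del: add_uminus_conv_diff)
      then have "near i (x j)"
        unfolding near_def using V_minus[OF i(2)] j(2) by blast
      then show ?thesis
        using near_unique near_self i j by blast
    qed
    then have "{i \<in> I. - t + x i \<in> V} \<subseteq> {i}" by blast
    then show ?thesis by (rule finite_subset) simp
  qed (simp only: finite.emptyI)
  then have "finite (\<Union>t\<in>C. {i \<in> I. - t + x i \<in> V})"
    using C(1) by blast
  moreover have "{i \<in> I. x i \<in> K} \<subseteq> (\<Union>t\<in>C. {i \<in> I. - t + x i \<in> V})"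
    using C(2) by auto
  ultimately show ?thesis
    by (rule finite_subset[rotated])
qed

text \<open>
  The bump sum takes the value \<open>z\<close> at infinitely many of the points, and all but finitely many of
  these lie where \<open>h\<close> is small.
\<close>

lemma norm_bump_sum_plus_C0_ge:
  assumes c: "\<And>i. cmod (c i) \<le> C" and J: "infinite {j \<in> I. c j = z}" and h: "h \<in> C0"
  shows "cmod z \<le> norm (bump_sum c + h)"
proof (rule field_le_epsilon)
  fix \<epsilon> :: real assume "\<epsilon> > 0"
  then obtain K where K: "compact K" "\<forall>t. t \<notin> K \<longrightarrow> cmod (h t) < \<epsilon>"
    using h unfolding C0_def by blast
  have "\<not> {j \<in> I. c j = z} \<subseteq> {i \<in> I. x i \<in> K}"
    using J finite_in_compact[OF K(1)] finite_subset by blast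
  then obtain j where j: "j \<in> I" "c j = z" "x j \<notin> K" by blast
  have "bump_sum c (x j) = z"
    by (simp add: apply_bump_sum[of c C, OF c] bump_sum_at_near[OF j(1) near_self] b_zero j(2))
  then have "z = (bump_sum c + h) (x j) - h (x j)"
    by simp
  then have "cmod z \<le> cmod ((bump_sum c + h) (x j)) + cmod (h (x j))"
    using norm_triangle_ineq4 by metis
  also have "\<dots> \<le> norm (bump_sum c + h) + \<epsilon>"
    using K(2) j(3) norm_bounded[of "bump_sum c + h" "x j"] by (intro add_mono) (simp_all add: less_imp_le)
  finally show "cmod z \<le> norm (bump_sum c + h) + \<epsilon>" .
qed

text \<open>
  A coordinate that occurred at a single point would give a function in \<open>C0\<close>.  Coordinates are
  therefore distributed over the points by a map \<open>\<pi>\<close> with infinite fibres.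
\<close>

lemma quotient_contains_isometric_linf_WAP0:
  fixes \<mu> :: "('a \<Rightarrow>\<^sub>C complex) \<Rightarrow> complex"
  assumes \<mu>: "invariant_mean_WAP \<mu>" and nc: "\<not> compact (UNIV :: 'a set)" and inf: "infinite I"
  shows "quotient_contains_isometric_linf (WAP0 \<mu>) C0 I"
proof -
  obtain \<pi> :: "'k \<Rightarrow> 'k" where \<pi>: "\<And>i. i \<in> I \<Longrightarrow> infinite {j \<in> I. \<pi> j = i}"
    using infinite_fibres_map[OF inf] by blast
  define f where "f \<xi> = bump_sum (\<lambda>i. \<xi> (\<pi> i))" for \<xi>
  have bound: "cmod (\<xi> (\<pi> i)) \<le> linf_norm I \<xi>" if "\<xi> \<in> linf I" for \<xi> i
    using cmod_le_linf_norm[OF that] .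
  have app: "f \<xi> t = bump_sum_at (\<lambda>i. \<xi> (\<pi> i)) t" if "\<xi> \<in> linf I" for \<xi> t
    unfolding f_def using apply_bump_sum[OF bound[OF that]] by simp
  have linf_add: "(\<lambda>i. \<xi> i + \<eta> i) \<in> linf I" if "\<xi> \<in> linf I" "\<eta> \<in> linf I" for \<xi> \<eta>
    using that bounded_plus_comp[of \<xi> I \<eta>] unfolding linf_def by simp
  have linf_scale: "(\<lambda>i. c * \<xi> i) \<in> linf I" if "\<xi> \<in> linf I" for c \<xi>
    using that bounded_linear_image[OF _ bounded_linear_mult_right[of c], of "\<xi> ` I"]
    unfolding linf_def by (simp add: image_image)
  have f_add: "f (\<lambda>i. \<xi> i + \<eta> i) = f \<xi> + f \<eta>" if "\<xi> \<in> linf I" "\<eta> \<in> linf I" for \<xi> \<eta>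
    by (rule bcontfun_eqI)
       (simp add: app that linf_add bump_sum_at_def distrib_right sum.distrib)
  have f_scale: "f (\<lambda>i. c * \<xi> i) = cscale c (f \<xi>)" if "\<xi> \<in> linf I" for c \<xi>
    by (rule bcontfun_eqI)
       (simp add: app that linf_scale bump_sum_at_def sum_distrib_left mult.assoc)
  have norm_f: "quotient_norm (f \<xi> +o C0) = linf_norm I \<xi>" if \<xi>: "\<xi> \<in> linf I" for \<xi>
  proof (rule antisym)
    have "f \<xi> \<in> f \<xi> +o C0"
      using zero_in_C0 unfolding elt_set_plus_def by force
    then have "quotient_norm (f \<xi> +o C0) \<le> norm (f \<xi>)"
      unfolding quotient_norm_def by (intro cINF_lower bdd_belowI[of _ 0]) auto
    also have "\<dots> \<le> linf_norm I \<xi>"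
      by (rule norm_bound) (simp add: app[OF \<xi>] cmod_bump_sum_at_le bound[OF \<xi>])
    finally show "quotient_norm (f \<xi> +o C0) \<le> linf_norm I \<xi>" .
    show "linf_norm I \<xi> \<le> quotient_norm (f \<xi> +o C0)"
      unfolding quotient_norm_def
    proof (rule cINF_greatest)
      show "f \<xi> +o C0 \<noteq> {}"
        using \<open>f \<xi> \<in> f \<xi> +o C0\<close> by blast
      fix u assume "u \<in> f \<xi> +o C0"
      then obtain h where h: "h \<in> C0" "u = f \<xi> + h"
        unfolding elt_set_plus_def by auto
      show "linf_norm I \<xi> \<le> norm u"
      proof (rule linf_norm_le)
        fix i assume i: "i \<in> I"
        have "infinite {j \<in> I. \<xi> (\<pi> j) = \<xi> i}"
          by (rule infinite_super[OF _ \<pi>[OF i]]) auto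
        then show "cmod (\<xi> i) \<le> norm u"
          unfolding h(2) f_def
          by (rule norm_bump_sum_plus_C0_ge[of "\<lambda>i. \<xi> (\<pi> i)", OF bound[OF \<xi>] _ h(1)])
      qed simp
    qed
  qed
  have "f \<xi> \<in> WAP0 \<mu>" if "\<xi> \<in> linf I" for \<xi>
    unfolding f_def by (rule bump_sum_in_WAP0[OF \<mu> nc bound[OF that]])
  then show ?thesis
    unfolding quotient_contains_isometric_linf_def quotient_space_def
    by (intro exI[of _ "\<lambda>\<xi>. f \<xi> +o C0"])
       (simp add: f_add f_scale norm_f coset_C0_add quotient_scale_coset_C0)
qed

end

theorem theorem4p1:
  fixes X :: "'a::{topological_group_add, t2_space} set"
    and \<kappa> :: "'k rel"
    and \<mu> :: "('a \<Rightarrow>\<^sub>C complex) \<Rightarrow> complex"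
  assumes "locally_compact_space (euclidean :: 'a topology)"
    and "\<not> compact (UNIV :: 'a set)"
    and "E_group TYPE('a)"
    and "E_set X"
    and "is_compact_covering_number X \<kappa>"
    and "invariant_mean_WAP \<mu>"
  shows "quotient_contains_isometric_linf (WAP0 \<mu>) C0 (Field \<kappa>)"
proof -
  note lc = assms(1)
  have X: "\<not> compact (closure X)"
    using assms(4) unfolding E_set_def by blast
  have inf: "infinite (Field \<kappa>)"
    using infinite_covering_number[OF assms(5) X] .
  have wo: "Well_order \<kappa>"
    using assms(5) card_order_on_well_order_on unfolding is_compact_covering_number_def by blast
  \<comment> \<open>The neighbourhoods are chosen from large to small: \<open>N\<close> is mapped into \<open>W\<close> by conjugation with
    elements of \<open>X\<close>, \<open>P\<close> lies in \<open>N\<close>, and two halvings of \<open>P\<close> give \<open>V\<close>.\<close>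
  obtain W :: "'a set" where W: "compact W" "0 \<in> interior W" "W \<subseteq> UNIV" "\<And>p. p \<in> W \<Longrightarrow> - p \<in> W"
    using compact_symmetric_nbhd[OF lc open_UNIV UNIV_I] by metis
  obtain N where N: "open N" "0 \<in> N" "\<And>u x. u \<in> N \<Longrightarrow> x \<in> X \<Longrightarrow> - x + u + x \<in> interior W"
      "\<And>u x. u \<in> N \<Longrightarrow> x \<in> X \<Longrightarrow> x + u - x \<in> interior W"
    using E_set_conjugation_nbhd[OF assms(4) open_interior W(2)] by metis
  obtain P where P: "compact P" "0 \<in> interior P" "P \<subseteq> N" "\<And>p. p \<in> P \<Longrightarrow> - p \<in> P"
    using compact_symmetric_nbhd[OF lc N(1,2)] by metis
  obtain V' where V': "open V'" "0 \<in> V'" "\<And>a. a \<in> V' \<Longrightarrow> - a \<in> V'"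
      "\<And>a b. a \<in> V' \<Longrightarrow> b \<in> V' \<Longrightarrow> a + b \<in> interior P"
    using symmetric_halving_nbhd[OF open_interior P(2)] by metis
  obtain V where V: "open V" "0 \<in> V" "\<And>a. a \<in> V \<Longrightarrow> - a \<in> V"
      "\<And>a b. a \<in> V \<Longrightarrow> b \<in> V \<Longrightarrow> a + b \<in> V'"
    using symmetric_halving_nbhd[OF V'(1,2)] by metis
  have V_sum: "a + b + c + d \<in> P" if "a \<in> V" "b \<in> V" "c \<in> V" "d \<in> V" for a b c d
    using subsetD[OF interior_subset V'(4)[OF V(4)[OF that(1,2)] V(4)[OF that(3,4)]]]
    by (simp only: add.assoc)
  have V_sum2: "a + b \<in> P" if "a \<in> V" "b \<in> V" for a b
    using V_sum[OF that V(2) V(2)] by simp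
  obtain b :: "'a \<Rightarrow>\<^sub>C complex"
    where b: "b 0 = 1" "\<And>t. b t \<noteq> 0 \<Longrightarrow> t \<in> V" "\<And>t. b t = complex_of_real (cmod (b t))"
      "\<And>t. cmod (b t) \<le> 1" "left_uniformly_continuous (apply_bcontfun b)"
    using uniformly_continuous_bump[OF lc V(1,2,3) P(1) V_sum2] by metis
  obtain x where xfree: "\<forall>i\<in>Field \<kappa>. x i \<in> X \<and>
    (\<forall>j\<in>underS \<kappa> i. \<forall>k\<in>underS \<kappa> i. \<forall>l\<in>underS \<kappa> i. \<forall>p\<in>P. \<forall>q\<in>P.
      x i \<noteq> x j + p - x k + x l + q)"
    using transfinite_free_sequence[OF assms(5) inf P(1)] by (rule exE)
  then have x: "\<And>i. i \<in> Field \<kappa> \<Longrightarrow> x i \<in> X"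
    and free: "\<And>i j k l p q. \<lbrakk>i \<in> Field \<kappa>; j \<in> underS \<kappa> i; k \<in> underS \<kappa> i; l \<in> underS \<kappa> i; p \<in> P; q \<in> P\<rbrakk> \<Longrightarrow>
      x i \<noteq> x j + p - x k + x l + q"
    by simp_all
  have P_zero: "0 \<in> P"
    using P(2) interior_subset by blast
  interpret sidon_bumps x "Field \<kappa>" V P W b
  proof
    show "x i + p - x i \<in> W" if "i \<in> Field \<kappa>" "p \<in> P" for i p
      using N(4)[OF subsetD[OF P(3) that(2)] x[OF that(1)]] interior_subset by blast
    show "\<exists>U'. open U' \<and> 0 \<in> U' \<and> (\<forall>u\<in>U'. \<forall>i\<in>Field \<kappa>. - x i + u + x i \<in> U)"
      if U: "open U" "0 \<in> U" for U
    proof -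
      obtain U' where U': "open U'" "0 \<in> U'" "\<And>u x. u \<in> U' \<Longrightarrow> x \<in> X \<Longrightarrow> - x + u + x \<in> U"
          "\<And>u x. u \<in> U' \<Longrightarrow> x \<in> X \<Longrightarrow> x + u - x \<in> U"
        using E_set_conjugation_nbhd[OF assms(4) U] by metis
      then show ?thesis
        using x by (intro exI[of _ U']) simp
    qed
    show "x i \<noteq> x j + p + q" if "i \<in> Field \<kappa>" "j \<in> Field \<kappa>" "i \<noteq> j" "p \<in> P" "q \<in> P" for i j p q
      using free_imp_sidon(1)[OF wo P_zero P(4) free that] .
    show "x i + p - x j \<noteq> x k + q - x l"
      if "i \<in> Field \<kappa>" "j \<in> Field \<kappa>" "k \<in> Field \<kappa>" "l \<in> Field \<kappa>" "distinct [i, j, k, l]" "p \<in> P" "q \<in> P"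
      for i j k l p q
      using free_imp_sidon(2)[OF wo P_zero P(4) free that] .
  qed (rule V V_sum P(1,4) W(1) b; assumption?)+
  show ?thesis
    by (rule quotient_contains_isometric_linf_WAP0[OF assms(6,2) inf])
qed

end
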